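(* For every $r$-tuple of partitions $(\lambda^{(1)}|\cdots|\lambda^{(r)})$, $$\mathcal{S}_{(\lambda^{(1)}|\cdots|\lambda^{(r)})}(X_1|\cdots|X_r) = \sum_{\sigma \in \mathcal{L}(\lambda^{(1)}|\cdots|\lambda^{(r)})} x^{\sigma}.$$
   Context: Key polynomials: for $\alpha\in\mathbb{Z}_{\ge0}^n$, $\mathcal{K}_\alpha(x_1,\dots,x_n)$ is determined by $\mathcal{K}_\alpha=x^\alpha$ if $\alpha_1\ge\cdots\ge\alpha_n$, and $\mathcal{K}_{s_i(\alpha)}=\xi_i(\mathcal{K}_\alpha)$ whenever $\alpha_i>\alpha_{i+1}$, where $\xi_i f=\frac{x_i f - x_{i+1}(s_i f)}{x_i-x_{i+1}}$ is the isobaric divided difference operator. For a partition $\lambda$, $\mathrm{rev}(\lambda)$ is $\lambda$ sorted into weakly increasing order, and $*$ denotes concatenation of compositions. The multi-symmetric Schur function is $$\mathcal{S}_{(\lambda^{(1)}|\cdots|\lambda^{(r)})}(X_1|\cdots|X_r)=\lim_{n_1,\dots,n_r\to\infty}\mathcal{K}_{(0^{n_1-\ell(\lambda^{(1)})}*\mathrm{rev}(\lambda^{(1)}))*\cdots*(0^{n_r-\ell(\lambda^{(r)})}*\mathrm{rev}(\lambda^{(r)}))}(x_{1,1},\dots,x_{1,n_1},\dots,x_{r,1},\dots,x_{r,n_r}),$$ where $X_j=x_{j,1}+x_{j,2}+\cdots$. Diagrams: for a composition $\mu=(\mu_1,\dots,\mu_n)$, the column diagram is $dg'(\mu)=\{(i,j):1\le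 i\le n,\ 1\le j\le\mu_i\}$ (column $i$ has height $\mu_i$), and the augmented diagram $\widehat{dg}(\mu)$ adds a basement row $\{(i,0):1\le i\le n\}$. Two distinct boxes attack if they are in the same row, or in consecutive rows with the box in the lower row strictly to the right of the box in the upper row. For $u=(i,j)$, let $d(u)=(i,j-1)$; $\mathrm{arm}(u)$ consists of boxes $(i',j)\in dg'(\mu)$ with $i'<i$ and $\mu_{i'}\le\mu_i$, together with boxes $(i',j-1)\in\widehat{dg}(\mu)$ with $i'>i$ and $\mu_{i'}<\mu_i$. A co-inversion triple $(u,v,w)$ has $w=d(u)$ and $v\in\mathrm{arm}(u)$, and is of Type 1 ($v$ in the row of $w$ to its right; the column of $u,w$ strictly taller than that of $v$) or Type 2 ($v$ in the row of $u$ to its left; the column of $u,w$ weakly taller than that of $v$), with labels satisfying $\sigma(u)<\sigma(v)<\sigma(w)$ or $\sigma(v)<\sigma(w)<\sigma(u)$ or $\sigma(w)<\sigma(u)<\sigma(v)$. Labels: the alphabet $\mathbb{N}(r)=\{i_j: i\ge1,\ 1\le j\le r\}$, extended by symbols $\omega_j+k$ ($1\le j\le r$, $k\ge0$), totally ordered by $a_1<\omega_1+b<c_2<\omega_2+d<\cdots<e_r<\omega_r+f$ (within each alphabet $j$, the $i_j$ are ordered by $i$, and the $\omega_j+k$ by $k$). Given $\sigma: dg'(\mathrm{rev}(\lambda^{(1)})*\cdots*\mathrm{rev}(\lambda^{(r)}))\to\mathbb{N}(r)$, let $\sigma^\star$ extend $\sigma$ to the augmented diagram by putting $\omega_i+j-1$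 in the basement box of column $\ell(\lambda^{(1)})+\cdots+\ell(\lambda^{(i-1)})+j$, for $1\le j\le\ell(\lambda^{(i)})$. Then $\mathcal{L}(\lambda^{(1)}|\cdots|\lambda^{(r)})$ is the set of such $\sigma$ for which $\sigma^\star$ is non-attacking (attacking boxes have distinct labels), weakly decreasing upwards in each column, and has no co-inversion triples. The weight is $x^\sigma=\prod_{j\ge1}\prod_{i\ge1}x_{j,i}^{|\sigma^{-1}(i_j)|}$. *)

theory Defs
  imports
    "HOL-Analysis.Infinite_Sum"
    "HOL-Combinatorics.Transposition"
    "HOL-Library.FuncSet"
    "HOL-Library.Poly_Mapping"
begin

text \<open>
  Conventions. Columns of diagrams, entries of compositions, the alphabets, and the letters and
  variables of each alphabet are numbered from 0; only the rows of diagrams keep the numbering in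
  which the basement is row 0. So the pair \<open>(j, i)\<close> stands for the variable $x_{j+1,i+1}$, and also
  for the letter $(i+1)_{j+1}$.
\<close>

section \<open>Key polynomials\<close>

text \<open>Polynomials over the integers in variables of type \<open>'v\<close>, as finitely supported families of
  coefficients indexed by exponent vectors.\<close>

type_synonym 'v mono = "'v \<Rightarrow>\<^sub>0 nat"
type_synonym 'v mpoly = "'v mono \<Rightarrow>\<^sub>0 int"

definition var :: "'v \<Rightarrow> 'v mpoly" where
  "var x = Poly_Mapping.single (Poly_Mapping.single x 1) 1"

definition swap_vars :: "'v \<Rightarrow> 'v \<Rightarrow> 'v mpoly \<Rightarrow> 'v mpoly" where
  "swap_vars x y f =
     Poly_Mapping.map_key (Poly_Mapping.map_key (Transposition.transpose x y)) f"

text \<open>For distinct \<open>x\<close> and \<open>y\<close> the quotient exists and is unique.\<close>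

definition isobaric_divdiff :: "'v \<Rightarrow> 'v \<Rightarrow> 'v mpoly \<Rightarrow> 'v mpoly" where
  "isobaric_divdiff x y f =
     (THE g. (var x - var y) * g = var x * f - var y * swap_vars x y f)"

text \<open>\<open>is_key xs \<alpha> f\<close>: the two rules yield \<open>f\<close> as the key polynomial of \<open>\<alpha>\<close> in the variables \<open>xs\<close>,
  which are meant to be distinct and as many as the entries of \<open>\<alpha>\<close>. That \<open>f\<close> does not depend on the
  order in which the second rule is applied is the well-definedness of key polynomials.\<close>

inductive is_key :: "'v list \<Rightarrow> nat list \<Rightarrow> 'v mpoly \<Rightarrow> bool" for xs :: "'v list" where
  dominant: "is_key xs \<alpha> (\<Prod>i<length xs. var (xs ! i) ^ (\<alpha> ! i))"
    if "length \<alpha> = length xs" and "sorted_wrt (\<ge>) \<alpha>"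
| step: "is_key xs (\<alpha>[i := \<alpha> ! Suc i, Suc i := \<alpha> ! i])
           (isobaric_divdiff (xs ! i) (xs ! Suc i) f)"
    if "is_key xs \<alpha> f" and "Suc i < length \<alpha>" and "\<alpha> ! i > \<alpha> ! Suc i"

definition key_poly :: "'v list \<Rightarrow> nat list \<Rightarrow> 'v mpoly" where
  "key_poly xs \<alpha> = (THE f. is_key xs \<alpha> f)"


section \<open>Multi-symmetric Schur functions\<close>

definition is_partition :: "nat list \<Rightarrow> bool" where
  "is_partition l \<longleftrightarrow> sorted_wrt (\<ge>) l \<and> 0 \<notin> set l"

text \<open>Both take the numbers of variables as a function \<open>n\<close>, of which only the values at
  \<open>j < length ls\<close> matter. As partitions are weakly decreasing, \<open>rev\<close> sorts them increasingly.\<close>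

definition block_vars :: "nat list list \<Rightarrow> (nat \<Rightarrow> nat) \<Rightarrow> (nat \<times> nat) list" where
  "block_vars ls n = concat (map (\<lambda>j. map (\<lambda>i. (j, i)) [0..<n j]) [0..<length ls])"

definition padded_comp :: "nat list list \<Rightarrow> (nat \<Rightarrow> nat) \<Rightarrow> nat list" where
  "padded_comp ls n =
     concat (map (\<lambda>j. replicate (n j - length (ls ! j)) 0 @ rev (ls ! j)) [0..<length ls])"

text \<open>The filter of all of \<open>n 0, \<dots>, n (r - 1)\<close> tending to infinity independently.\<close>

definition all_at_top :: "nat \<Rightarrow> (nat \<Rightarrow> nat) filter" where
  "all_at_top r = (INF j\<in>{..<r}. filtercomap (\<lambda>n. n j) at_top)"

text \<open>A formal power series in infinitely many variables is given by its coefficients, and the limit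
  is the coefficientwise one (the integers being discrete).\<close>

definition multi_schur :: "nat list list \<Rightarrow> (nat \<times> nat) mono \<Rightarrow> int" where
  "multi_schur ls m =
     Lim (all_at_top (length ls))
       (\<lambda>n. Poly_Mapping.lookup (key_poly (block_vars ls n) (padded_comp ls n)) m)"


section \<open>Diagrams\<close>

type_synonym box = "nat \<times> nat"

definition dg :: "nat list \<Rightarrow> box set" where
  "dg \<mu> = {(i, j). i < length \<mu> \<and> 1 \<le> j \<and> j \<le> \<mu> ! i}"

definition aug_dg :: "nat list \<Rightarrow> box set" where
  "aug_dg \<mu> = dg \<mu> \<union> {(i, 0) | i. i < length \<mu>}"

definition attacking :: "box \<Rightarrow> box \<Rightarrow> bool" where
  "attacking u v \<longleftrightarrow> u \<noteq> v \<and>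
     (snd u = snd v \<or>
      snd u = Suc (snd v) \<and> fst u < fst v \<or>
      snd v = Suc (snd u) \<and> fst v < fst u)"

fun box_below :: "box \<Rightarrow> box" where
  "box_below (i, j) = (i, j - 1)"

fun arm :: "nat list \<Rightarrow> box \<Rightarrow> box set" where
  "arm \<mu> (i, j) =
     {(i', j) | i'. (i', j) \<in> dg \<mu> \<and> i' < i \<and> \<mu> ! i' \<le> \<mu> ! i} \<union>
     {(i', j - 1) | i'. (i', j - 1) \<in> aug_dg \<mu> \<and> i < i' \<and> \<mu> ! i' < \<mu> ! i}"


section \<open>Labels and fillings\<close>

text \<open>\<open>Letter j i\<close> is the letter $(i+1)_{j+1}$ and \<open>Omega j k\<close> is the symbol $\omega_{j+1}+k$.\<close>

datatype label = Letter nat nat | Omega nat nat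

instantiation label :: linorder
begin

fun less_label :: "label \<Rightarrow> label \<Rightarrow> bool" where
  "Letter a i < Letter b k \<longleftrightarrow> a < b \<or> a = b \<and> i < k"
| "Letter a i < Omega b k \<longleftrightarrow> a \<le> b"
| "Omega a i < Letter b k \<longleftrightarrow> a < b"
| "Omega a i < Omega b k \<longleftrightarrow> a < b \<or> a = b \<and> i < k"

definition less_eq_label :: "label \<Rightarrow> label \<Rightarrow> bool" where
  "x \<le> y \<longleftrightarrow> x < y \<or> x = (y :: label)"

instance
proof
  fix x y z :: label
  show "x < y \<longleftrightarrow> x \<le> y \<and> \<not> y \<le> x"
    by (cases x; cases y) (auto simp: less_eq_label_def)
  show "x \<le> x"
    by (simp add: less_eq_label_def)
  show "x \<le> y \<Longrightarrow> y \<le> z \<Longrightarrow> x \<le> z"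
    by (cases x; cases y; cases z) (auto simp: less_eq_label_def)
  show "x \<le> y \<Longrightarrow> y \<le> x \<Longrightarrow> x = y"
    by (cases x; cases y) (auto simp: less_eq_label_def)
  show "x \<le> y \<or> y \<le> x"
    by (cases x; cases y) (auto simp: less_eq_label_def)
qed

end

definition shape :: "nat list list \<Rightarrow> nat list" where
  "shape ls = concat (map rev ls)"

definition basement :: "nat list list \<Rightarrow> label list" where
  "basement ls = concat (map (\<lambda>j. map (Omega j) [0..<length (ls ! j)]) [0..<length ls])"

definition augment :: "nat list list \<Rightarrow> (box \<Rightarrow> nat \<times> nat) \<Rightarrow> box \<Rightarrow> label" where
  "augment ls \<sigma> u =
     (if snd u = 0 then basement ls ! fst u else case \<sigma> u of (j, i) \<Rightarrow> Letter j i)"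

definition non_attacking :: "nat list \<Rightarrow> (box \<Rightarrow> label) \<Rightarrow> bool" where
  "non_attacking \<mu> \<tau> \<longleftrightarrow>
     (\<forall>u \<in> aug_dg \<mu>. \<forall>v \<in> aug_dg \<mu>. attacking u v \<longrightarrow> \<tau> u \<noteq> \<tau> v)"

definition decreasing_upwards :: "nat list \<Rightarrow> (box \<Rightarrow> label) \<Rightarrow> bool" where
  "decreasing_upwards \<mu> \<tau> \<longleftrightarrow> (\<forall>u \<in> dg \<mu>. \<tau> u \<le> \<tau> (box_below u))"

definition coinversion_triple ::
    "nat list \<Rightarrow> (box \<Rightarrow> label) \<Rightarrow> box \<Rightarrow> box \<Rightarrow> box \<Rightarrow> bool" where
  "coinversion_triple \<mu> \<tau> u v w \<longleftrightarrow>
     u \<in> dg \<mu> \<and> w = box_below u \<and> v \<in> arm \<mu> u \<and>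
     (\<tau> u < \<tau> v \<and> \<tau> v < \<tau> w \<or> \<tau> v < \<tau> w \<and> \<tau> w < \<tau> u \<or> \<tau> w < \<tau> u \<and> \<tau> u < \<tau> v)"

text \<open>Fillings are extensional functions, so that each is determined by its values on the diagram.\<close>

definition fillings :: "nat list list \<Rightarrow> (box \<Rightarrow> nat \<times> nat) set" where
  "fillings ls =
     {\<sigma> \<in> dg (shape ls) \<rightarrow>\<^sub>E {(j, i). j < length ls}.
        non_attacking (shape ls) (augment ls \<sigma>) \<and>
        decreasing_upwards (shape ls) (augment ls \<sigma>) \<and>
        (\<nexists>u v w. coinversion_triple (shape ls) (augment ls \<sigma>) u v w)}"

text \<open>The finite product over the letters that occur is the whole product, since the other factors
  have exponent 0.\<close>

definition filling_weight :: "nat list list \<Rightarrow> (box \<Rightarrow> nat \<times> nat) \<Rightarrow> (nat \<times> nat) mpoly" where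
  "filling_weight ls \<sigma> =
     (\<Prod>x \<in> \<sigma> ` dg (shape ls). var x ^ card {u \<in> dg (shape ls). \<sigma> u = x})"

end

theory Submission
  imports Defs "HOL-Library.Product_Lexorder"
begin

text \<open>
  If columns weakly decrease upwards, a co-inversion triple must satisfy
  \<open>\<sigma>(u) < \<sigma>(v) < \<sigma>(w)\<close>. Hence, when the boxes are filled row by row, each row from left to right,
  the three conditions on a filling become a condition on the single label being written: the label
  of the current column may only move down, to a value not in use, and on its way it must not meet
  the label of a column that is smaller for the lexicographic order of (height, position). This
  makes the generating polynomial an iterated sum of one-box moves, defined for an arbitrary injective
  basement.

  Exchanging the labels \<open>a\<close> and \<open>a + 1\<close> in the basement acts on this polynomial by the operator
  $\xi_a$ or by $\xi_a - 1$, which is shown one box at a time. Starting from the basement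
  in which taller columns carry smaller labels, where the polynomial is a monomial, these relations
  reach every basement. This shows that a shorter column may be moved past a taller neighbour, and then
  that the polynomials of the increasing basement obey the recursion of key polynomials. Empty columns
  do not constrain the others, and for a fixed monomial the basement letters of a large block behave
  like the symbols \<open>\<omega>\<^sub>j + k\<close>.
\<close>

section \<open>Isobaric divided differences\<close>

text \<open>The key recursion exchanges two entries of a composition, hence the heights over two
  adjacent positions, while an induction along the filling has to keep the columns and can vary only
  the basement. The two effects are separated: exchanging labels over fixed columns gives the
  operator, and moving two columns together with their labels changes nothing when the taller one
  carries the smaller label. Once some boxes are filled, the current labels are neither in order nor
  without gaps; therefore the basement is arbitrary injective, and the exchange is studied also when
  only one or none of the two labels is present. Whether \<xi> or \<xi> - 1 occurs depends on which
  column is read first, and this changes whenever a column goes to the end of the queue. The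
  lexicographic order comes from the arms: they meet the weakly shorter columns on the left and the
  strictly shorter ones on the right. Well-definedness of key polynomials is not presupposed:
  whatever the recursion yields is shown to be the generating polynomial.\<close>

lemma inj_map_key_transpose:
  "inj (Poly_Mapping.map_key (Transposition.transpose x y) :: 'v mono \<Rightarrow> 'v mono)"
\<comment> \<open>Injectivity is what makes the outer \<open>map_key\<close> in
  \<open>swap_vars\<close> act by composition.\<close>
proof (rule inj_on_inverseI)
  fix m :: "'v mono"
  show "Poly_Mapping.map_key (Transposition.transpose x y)
      (Poly_Mapping.map_key (Transposition.transpose x y) m) = m"
    by (simp add: map_key_compose map_key_id[unfolded id_def[symmetric]] flip: id_def)
qed

lemma swap_vars_add: "swap_vars x y (f + g) = swap_vars x y f + swap_vars x y g"
  by (simp add: swap_vars_def map_key_plus[OF inj_map_key_transpose])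

lemma swap_vars_0 [simp]: "swap_vars x y 0 = 0"
  by (simp add: swap_vars_def inj_map_key_transpose)

lemma swap_vars_diff: "swap_vars x y (f - g) = swap_vars x y f - swap_vars x y g"
  using swap_vars_add[of x y "f - g" g] by (simp add: eq_diff_eq)

lemma swap_vars_single:
  "swap_vars x y (Poly_Mapping.single m c) =
   Poly_Mapping.single (Poly_Mapping.map_key (Transposition.transpose x y) m) c"
proof -
  have "m = Poly_Mapping.map_key (Transposition.transpose x y)
      (Poly_Mapping.map_key (Transposition.transpose x y) m)"
    by (simp add: map_key_compose map_key_id[unfolded id_def[symmetric]] flip: id_def)
  then show ?thesis
    unfolding swap_vars_def by (metis inj_map_key_transpose map_key_single)
qed

lemma update_eq_add_single:
  "k \<notin> Poly_Mapping.keys h \<Longrightarrow> Poly_Mapping.update k v h = h + Poly_Mapping.single k v"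
  by (auto intro!: poly_mapping_eqI simp: lookup_update lookup_add lookup_single in_keys_iff)

lemma swap_vars_mult: "swap_vars x y (f * g) = swap_vars x y f * swap_vars x y g"
proof -
  let ?t = "Poly_Mapping.map_key (Transposition.transpose x y)"
  have single: "swap_vars x y (Poly_Mapping.single m c * g)
      = swap_vars x y (Poly_Mapping.single m c) * swap_vars x y g" for m c
  proof (induction g rule: update_induct)
    case const
    show ?case by simp
  next
    case (update h k v)
    then show ?case
      by (simp add: update_eq_add_single distrib_left swap_vars_add swap_vars_single mult_single map_key_plus)
  qed
  show ?thesis
  proof (induction f rule: update_induct)
    case const
    show ?case by simp
  next
    case (update h k v)
    then show ?case
      by (simp add: update_eq_add_single distrib_right swap_vars_add single)
  qed
qed

lemma swap_vars_var: "swap_vars x y (var z) = var (Transposition.transpose x y z)"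
proof -
  have "Poly_Mapping.map_key (Transposition.transpose x y)
      (Poly_Mapping.single (Transposition.transpose x y (Transposition.transpose x y z)) (1::nat)) =
      Poly_Mapping.single (Transposition.transpose x y z) 1"
    by (rule map_key_single) simp
  then show ?thesis
    by (simp add: var_def swap_vars_single)
qed

lemma swap_vars_1 [simp]: "swap_vars x y 1 = 1"
  by (metis map_key_zero inj_transpose single_one swap_vars_single)

lemma swap_vars_swap_vars [simp]: "swap_vars x y (swap_vars x y f) = f"
proof (induction f rule: update_induct)
  case const
  show ?case by simp
next
  case (update h k v)
  then show ?case
    by (simp add: update_eq_add_single swap_vars_add swap_vars_single map_key_compose map_key_id[unfolded id_def[symmetric]] flip: id_def)
qed

lemma var_diff_nonzero: "x \<noteq> y \<Longrightarrow> var x - var y \<noteq> 0"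
  by (metis eq_iff_diff_eq_0 inj_single injD one_neq_zero lookup_single_eq lookup_single_not_eq var_def)

text \<open>The operator as a relation, so that the existence of the quotient need not be shown in advance:
  it results from the recursion for the generating polynomials.\<close>

definition is_divdiff :: "'v \<Rightarrow> 'v \<Rightarrow> 'v mpoly \<Rightarrow> 'v mpoly \<Rightarrow> bool" where
  "is_divdiff x y f g \<longleftrightarrow> (var x - var y) * g = var x * f - var y * swap_vars x y f"

text \<open>The order on the variables induces one on monomials, so that polynomials have no zero
  divisors and \<open>var x - var y\<close> can be cancelled.\<close>

lemma is_divdiff_unique:
  fixes x y :: "'v::linorder"
  assumes "x \<noteq> y" "is_divdiff x y f g" "is_divdiff x y f h"
  shows "g = h"
  using assms var_diff_nonzero[OF assms(1)] unfolding is_divdiff_def by (metis mult_left_cancel)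

lemma isobaric_divdiff_eqI:
  fixes x y :: "'v::linorder"
  assumes "x \<noteq> y" "is_divdiff x y f g"
  shows "isobaric_divdiff x y f = g"
  unfolding isobaric_divdiff_def
  using assms is_divdiff_unique unfolding is_divdiff_def by (intro the_equality) blast+

lemma is_divdiff_symmetric_iff:
  fixes x y :: "'v::linorder"
  assumes "x \<noteq> y"
  shows "is_divdiff x y f f \<longleftrightarrow> swap_vars x y f = f"
proof -
  have "var y \<noteq> (0::'v mpoly)"
    by (metis lookup_single_eq lookup_zero var_def zero_neq_one)
  moreover have "(var x - var y) * f = var x * f - var y * f"
    by (simp add: algebra_simps)
  ultimately show ?thesis
    by (auto simp: is_divdiff_def)
qed

text \<open>Swapping the variables in the defining equation shows that \<open>g\<close> is
  symmetric. The use of this: a polynomial known to be a value of the operator is fixed by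
  it.\<close>

lemma is_divdiff_idem:
  fixes x y :: "'v::linorder"
  assumes "x \<noteq> y" "is_divdiff x y f g"
  shows "is_divdiff x y g g"
proof -
  have "swap_vars x y ((var x - var y) * g + var y * swap_vars x y f) = swap_vars x y (var x * f)"
    using assms(2) by (simp add: is_divdiff_def)
  then have "(var y - var x) * swap_vars x y g + var x * f = var y * swap_vars x y f"
    by (simp add: swap_vars_add swap_vars_diff swap_vars_mult swap_vars_var)
  then have "(var x - var y) * swap_vars x y g = (var x - var y) * g"
    using assms(2) unfolding is_divdiff_def by algebra
  with var_diff_nonzero[OF assms(1)] have "swap_vars x y g = g"
    by simp
  with assms(1) show ?thesis
    by (simp add: is_divdiff_symmetric_iff)
qed

lemma is_divdiff_0: "is_divdiff x y 0 0"
  by (simp add: is_divdiff_def)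

lemma is_divdiff_add:
  "is_divdiff x y f g \<Longrightarrow> is_divdiff x y f' g' \<Longrightarrow> is_divdiff x y (f + f') (g + g')"
  by (simp add: is_divdiff_def swap_vars_add algebra_simps)

lemma is_divdiff_sum:
  "(\<And>a. a \<in> A \<Longrightarrow> is_divdiff x y (f a) (g a)) \<Longrightarrow> is_divdiff x y (sum f A) (sum g A)"
  by (induction A rule: infinite_finite_induct) (simp_all add: is_divdiff_0 is_divdiff_add)

lemma is_divdiff_mult:
  assumes "swap_vars x y h = h" "is_divdiff x y f g"
  shows "is_divdiff x y (h * f) (h * g)"
  using arg_cong[OF assms(2)[unfolded is_divdiff_def], of "\<lambda>u. h * u"]
  by (simp add: is_divdiff_def swap_vars_mult assms(1) algebra_simps)

text \<open>The swap does not fix the variables of the labels \<open>a\<close> and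
  \<open>Suc a\<close>, so \<open>is_divdiff_mult\<close> does not cover boxes receiving them; this
  product rule and the two after it do.\<close>

lemma is_divdiff_var_add:
  assumes "is_divdiff x y f g"
  shows "is_divdiff x y (var x * f) (var x * f + var y * g)"
  using arg_cong[OF assms[unfolded is_divdiff_def], of "\<lambda>u. var y * u"]
  by (simp add: is_divdiff_def swap_vars_mult swap_vars_var algebra_simps)

lemma is_divdiff_var_annihilates:
  fixes x y :: "'v::linorder"
  assumes "x \<noteq> y" "is_divdiff x y g g"
  shows "is_divdiff x y (var y * g) 0"
  using assms by (simp add: is_divdiff_symmetric_iff) (simp add: is_divdiff_def swap_vars_mult swap_vars_var)

text \<open>Here \<open>h\<close> is the value of \<xi> - 1 at \<open>g\<close>: one more variable
  turns a relation for \<xi> - 1 into one for \<xi>.\<close>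

lemma is_divdiff_var_shift:
  assumes "is_divdiff x y g (g + h)"
  shows "is_divdiff x y (var y * g) (var x * h)"
  using arg_cong[OF assms[unfolded is_divdiff_def], of "\<lambda>u. var x * u"]
  by (simp add: is_divdiff_def swap_vars_mult swap_vars_var algebra_simps)

section \<open>Generating polynomials of fillings with an arbitrary basement\<close>

text \<open>\<open>b\<close> assigns to each column its current label. Columns are named by natural numbers whose order
  is the lexicographic order of (height, position).\<close>

definition targets :: "nat set \<Rightarrow> nat \<Rightarrow> (nat \<Rightarrow> 'l::linorder) \<Rightarrow> 'l set" where
  "targets Q p b = {e. e \<le> b p \<and> (\<forall>r\<in>Q. b r \<noteq> e) \<and> (\<forall>r\<in>Q. r < p \<longrightarrow> \<not> (e \<le> b r \<and> b r \<le> b p))}"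

lemma finite_targets [simp]: "finite (targets Q p (b :: nat \<Rightarrow> nat))"
  by (rule finite_subset[of _ "{..b p}"]) (auto simp: targets_def)

lemma targets_cong: "(\<And>r. r \<in> insert p Q \<Longrightarrow> b r = b' r) \<Longrightarrow> targets Q p b = targets Q p b'"
  by (auto simp: targets_def)

definition names :: "(nat \<times> nat) list \<Rightarrow> nat set" where
  "names q = fst ` set q"

lemma names_simps [simp]:
  "names [] = {}" "names (x # q) = insert (fst x) (names q)" "names (q @ q') = names q \<union> names q'"
  by (auto simp: names_def)

lemma finite_names [simp]: "finite (names q)"
  by (simp add: names_def)

text \<open>An entry \<open>(p, k)\<close> of the queue is a column \<open>p\<close> with \<open>k\<close> boxes left to fill. The head of the queue is
  the next column in reading order; a column in which a box has been filled goes to the end, as its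
  next box lies in the next row.\<close>

function gen_poly :: "'v list \<Rightarrow> (nat \<times> nat) list \<Rightarrow> (nat \<Rightarrow> nat) \<Rightarrow> 'v mpoly" where
  "gen_poly xs [] b = 1"
| "gen_poly xs ((p, 0) # q) b = gen_poly xs q b"
| "gen_poly xs ((p, Suc k) # q) b =
     (\<Sum>e\<in>targets (names q) p b. var (xs ! e) * gen_poly xs (q @ [(p, k)]) (b(p := e)))"
  by pat_completeness auto
termination
  by (relation "measure (\<lambda>(xs, q, b). sum_list (map (\<lambda>(p, k). Suc k) q))") auto

lemma gen_poly_cong:
  "(\<And>r. r \<in> names q \<Longrightarrow> b r = b' r) \<Longrightarrow> gen_poly xs q b = gen_poly xs q b'"
proof (induction xs q b arbitrary: b' rule: gen_poly.induct)
  case (1 xs b)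
  then show ?case by simp
next
  case (2 xs p q b)
  then show ?case by simp
next
  case (3 xs p k q b)
  have *: "targets (names q) p b = targets (names q) p b'"
    using 3(2) by (intro targets_cong) auto
  show ?case
    unfolding gen_poly.simps * by (intro sum.cong refl arg_cong2[of _ _ _ _ "(*)"] 3(1)) (use * 3(2) in auto)
qed

fun before :: "nat \<Rightarrow> nat \<Rightarrow> (nat \<times> nat) list \<Rightarrow> bool" where
  "before P R [] \<longleftrightarrow> False"
| "before P R (x # q) \<longleftrightarrow> fst x = P \<and> R \<in> names q \<or> before P R q"

lemma before_append:
  "before P R (q @ q') \<longleftrightarrow> before P R q \<or> before P R q' \<or> P \<in> names q \<and> R \<in> names q'"
  by (induction q) auto

lemma before_in: "before P R q \<Longrightarrow> P \<in> names q \<and> R \<in> names q"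
  by (induction q) auto

lemma before_total:
  "P \<in> names q \<Longrightarrow> R \<in> names q \<Longrightarrow> P \<noteq> R \<Longrightarrow> before P R q \<or> before R P q"
  by (induction q) auto

text \<open>The order of names can be read off the queue: heights are compared by what is left to fill, and
  ties are broken by the reading order.\<close>

definition valid_queue :: "(nat \<times> nat) list \<Rightarrow> bool" where
  "valid_queue q \<longleftrightarrow> distinct (map fst q) \<and> sorted_wrt (\<lambda>(p, k) (r, l). p < r \<longleftrightarrow> k \<le> l) q"

lemma valid_queue_ConsD: "valid_queue (x # q) \<Longrightarrow> valid_queue q"
  by (simp add: valid_queue_def)

text \<open>Zero boxes left is at most what any later entry has left, so an exhausted head is the
  smaller column of every pair it belongs to.\<close>

lemma valid_queue_min:
  "valid_queue ((p, 0) # q) \<Longrightarrow> r \<in> names q \<Longrightarrow> p < r"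
  by (auto simp: valid_queue_def names_def)

text \<open>For distinct names, negating \<open>p < r \<longleftrightarrow> Suc k \<le> l\<close>
  gives \<open>r < p \<longleftrightarrow> l \<le> k\<close>: losing one box makes up for going from
  first to last in the tie-break.\<close>

lemma valid_queue_rotate: "valid_queue ((p, Suc k) # q) \<Longrightarrow> valid_queue (q @ [(p, k)])"
  by (force simp: valid_queue_def sorted_wrt_append)

definition swp :: "nat \<Rightarrow> (nat \<Rightarrow> nat) \<Rightarrow> nat \<Rightarrow> nat" where
  "swp a b = Transposition.transpose a (Suc a) \<circ> b"

lemma swp_apply: "swp a b r = (if b r = a then Suc a else if b r = Suc a then a else b r)"
  by (simp add: swp_def transpose_def)

lemma swp_swp [simp]: "swp a (swp a b) = b"
  by (auto simp: fun_eq_iff swp_apply)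

lemma swp_upd: "e \<noteq> a \<Longrightarrow> e \<noteq> Suc a \<Longrightarrow> (swp a b)(p := e) = swp a (b(p := e))"
  by (auto simp: fun_eq_iff swp_apply)

lemma gen_poly_swp_absent:
  "(\<And>r. r \<in> names q \<Longrightarrow> b r \<noteq> a \<and> b r \<noteq> Suc a) \<Longrightarrow> gen_poly xs q (swp a b) = gen_poly xs q b"
  by (intro gen_poly_cong) (auto simp: swp_apply)

definition admissible :: "nat \<Rightarrow> (nat \<times> nat) list \<Rightarrow> (nat \<Rightarrow> nat) \<Rightarrow> bool" where
  "admissible n q b \<longleftrightarrow> inj_on b (names q) \<and> (\<forall>r\<in>names q. b r < n)"

lemma admissible_eqD: "admissible n q b \<Longrightarrow> r \<in> names q \<Longrightarrow> s \<in> names q \<Longrightarrow> b r = b s \<Longrightarrow> r = s"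
  by (auto simp: admissible_def inj_on_def)

text \<open>How the generating polynomial changes when \<open>a\<close> and \<open>Suc a\<close> are exchanged in the basement. If both
  labels occur and the larger column has the smaller one, the relation depends on which of the two columns
  is read first: exchanging then amounts to $\xi_a$ or to $\xi_a - 1$.\<close>

definition exchange :: "'v list \<Rightarrow> nat \<Rightarrow> (nat \<times> nat) list \<Rightarrow> (nat \<Rightarrow> nat) \<Rightarrow> bool" where
  "exchange xs a q b \<longleftrightarrow>
    ((\<forall>r\<in>names q. b r \<noteq> a \<and> b r \<noteq> Suc a) \<longrightarrow>
       is_divdiff (xs ! a) (xs ! Suc a) (gen_poly xs q b) (gen_poly xs q b)) \<and>
    (\<forall>P \<in> names q. b P = a \<and> (\<forall>r\<in>names q. b r \<noteq> Suc a) \<longrightarrow>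
       is_divdiff (xs ! a) (xs ! Suc a) (gen_poly xs q b) (gen_poly xs q (swp a b))) \<and>
    (\<forall>P R. b P = a \<and> b R = Suc a \<and> R < P \<and> before R P q \<longrightarrow>
       is_divdiff (xs ! a) (xs ! Suc a) (gen_poly xs q b) (gen_poly xs q (swp a b))) \<and>
    (\<forall>P R. b P = a \<and> b R = Suc a \<and> R < P \<and> before P R q \<longrightarrow>
       is_divdiff (xs ! a) (xs ! Suc a) (gen_poly xs q b) (gen_poly xs q b + gen_poly xs q (swp a b)))"

lemma exchangeD:
  assumes "exchange xs a q b"
  shows "(\<And>r. r \<in> names q \<Longrightarrow> b r \<noteq> a \<and> b r \<noteq> Suc a) \<Longrightarrow>
       is_divdiff (xs ! a) (xs ! Suc a) (gen_poly xs q b) (gen_poly xs q b)"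
   and "P \<in> names q \<Longrightarrow> b P = a \<Longrightarrow> (\<And>r. r \<in> names q \<Longrightarrow> b r \<noteq> Suc a) \<Longrightarrow>
       is_divdiff (xs ! a) (xs ! Suc a) (gen_poly xs q b) (gen_poly xs q (swp a b))"
   and "before R P q \<Longrightarrow> b P = a \<Longrightarrow> b R = Suc a \<Longrightarrow> R < P \<Longrightarrow>
       is_divdiff (xs ! a) (xs ! Suc a) (gen_poly xs q b) (gen_poly xs q (swp a b))"
   and "before P R q \<Longrightarrow> b P = a \<Longrightarrow> b R = Suc a \<Longrightarrow> R < P \<Longrightarrow>
       is_divdiff (xs ! a) (xs ! Suc a) (gen_poly xs q b) (gen_poly xs q b + gen_poly xs q (swp a b))"
  using assms unfolding exchange_def by blast+

text \<open>The dropped column takes its label along, so the case of two labels can become that of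
  one, and the case of one that of none.\<close>

lemma exchange_remove:
  assumes valid: "valid_queue ((p, 0) # q)" and b: "admissible n ((p, 0) # q) b"
    and IH: "exchange xs a q b"
  shows "exchange xs a ((p, 0) # q) b"
proof -
  have p: "p \<notin> names q"
    using valid by (auto simp: valid_queue_def names_def)
  have gt: "p < r" if "r \<in> names q" for r
    using valid_queue_min[OF valid that] .
  note in_q = before_in[of _ _ q]
  note eqD = admissible_eqD[OF b]
  show ?thesis
    unfolding exchange_def
  proof (intro conjI allI ballI impI; (elim conjE)?)
    assume "\<forall>r\<in>names ((p, 0) # q). b r \<noteq> a \<and> b r \<noteq> Suc a"
    then show "is_divdiff (xs ! a) (xs ! Suc a) (gen_poly xs ((p, 0) # q) b) (gen_poly xs ((p, 0) # q) b)"
      using exchangeD(1)[OF IH] by simp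
  next
    fix P assume P: "P \<in> names ((p, 0) # q)" "b P = a" "\<forall>r\<in>names ((p, 0) # q). b r \<noteq> Suc a"
    show "is_divdiff (xs ! a) (xs ! Suc a) (gen_poly xs ((p, 0) # q) b) (gen_poly xs ((p, 0) # q) (swp a b))"
    proof (cases "P = p")
      case True
      have a: "b r \<noteq> a \<and> b r \<noteq> Suc a" if "r \<in> names q" for r
      proof -
        have "b r \<noteq> b p"
          using eqD[of r p] that p by auto
        then show ?thesis
          using P True that by auto
      qed
      then have "gen_poly xs q (swp a b) = gen_poly xs q b"
        by (intro gen_poly_swp_absent)
      then show ?thesis
        using exchangeD(1)[OF IH a] by simp
    next
      case False
      then show ?thesis
        using exchangeD(2)[OF IH, of P] P by auto
    qed
  next
    fix P R assume *: "b P = a" "b R = Suc a" "R < P" "before R P ((p, 0) # q)"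
    show "is_divdiff (xs ! a) (xs ! Suc a) (gen_poly xs ((p, 0) # q) b) (gen_poly xs ((p, 0) # q) (swp a b))"
    proof (cases "R = p")
      case True
      then have "P \<in> names q"
        using * by (auto dest: in_q)
      moreover have "b r \<noteq> Suc a" if "r \<in> names q" for r
      proof -
        have "b r \<noteq> b p"
          using eqD[of r p] that p by auto
        then show ?thesis
          using * True by simp
      qed
      ultimately show ?thesis
        using exchangeD(2)[OF IH, of P] * by simp
    next
      case False
      then show ?thesis
        using exchangeD(3)[OF IH, of R P] * by auto
    qed
  next
    fix P R assume *: "b P = a" "b R = Suc a" "R < P" "before P R ((p, 0) # q)"
    \<comment> \<open>The dropped column is minimal, so it cannot be \<open>P\<close>, which exceeds
      \<open>R\<close>.\<close>
    then have "before P R q"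
      using gt[of R] by auto
    then show "is_divdiff (xs ! a) (xs ! Suc a) (gen_poly xs ((p, 0) # q) b)
        (gen_poly xs ((p, 0) # q) b + gen_poly xs ((p, 0) # q) (swp a b))"
      using exchangeD(4)[OF IH, of P R] * by simp
  qed
qed

section \<open>Exchanging two adjacent labels while one box is filled\<close>

context
  fixes xs :: "'v::linorder list" and a p k :: nat and q :: "(nat \<times> nat) list"
  assumes xs: "distinct xs" "Suc a < length xs"
    and valid: "valid_queue ((p, Suc k) # q)"
    and IH: "\<And>b. admissible (length xs) (q @ [(p, k)]) b \<Longrightarrow> exchange xs a (q @ [(p, k)]) b"
begin

abbreviation (input) "divdiff \<equiv> is_divdiff (xs ! a) (xs ! Suc a)"
abbreviation (input) "rotated \<equiv> gen_poly xs (q @ [(p, k)])"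
abbreviation (input) "moves \<equiv> targets (names q) p"
abbreviation (input) "adm \<equiv> admissible (length xs) (q @ [(p, k)])"

lemma p_notin: "p \<notin> names q"
  using valid by (auto simp: valid_queue_def names_def)

lemma adjacent_distinct: "xs ! a \<noteq> xs ! Suc a"
  using xs by (simp add: nth_eq_iff_index_eq)

lemma swap_var_other:
  "e \<noteq> a \<Longrightarrow> e \<noteq> Suc a \<Longrightarrow> e < length xs \<Longrightarrow>
    swap_vars (xs ! a) (xs ! Suc a) (var (xs ! e)) = var (xs ! e)"
  using xs by (simp add: swap_vars_var transpose_def nth_eq_iff_index_eq)

lemma target_less: "adm b \<Longrightarrow> e \<in> moves b \<Longrightarrow> e < length xs"
  by (auto simp: targets_def admissible_def)

lemma adm_upd: "adm b \<Longrightarrow> e \<in> moves b \<Longrightarrow> adm (b(p := e))"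
  using p_notin target_less[of b e]
  by (auto simp: targets_def inj_on_def admissible_def)

lemma divdiff_mult_var:
  "adm b \<Longrightarrow> e \<in> moves b \<Longrightarrow> e \<noteq> a \<Longrightarrow> e \<noteq> Suc a \<Longrightarrow> divdiff f g \<Longrightarrow> divdiff (var (xs ! e) * f) (var (xs ! e) * g)"
  by (intro is_divdiff_mult swap_var_other target_less)

lemma not_target: "P \<in> names q \<Longrightarrow> b P = e \<Longrightarrow> e \<notin> moves b"
  by (auto simp: targets_def)

lemma own_target: "adm b \<Longrightarrow> b p \<in> moves b"
  using p_notin by (auto simp: targets_def dest: admissible_eqD)

lemma adm_swp: "adm b \<Longrightarrow> adm (swp a b)"
  using xs(2) by (auto simp: admissible_def inj_on_def swp_apply split: if_splits)

lemma gen_poly_split: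
  "gen_poly xs ((p, Suc k) # q) b =
    (\<Sum>e\<in>moves b - {a, Suc a}. var (xs ! e) * rotated (b(p := e))) +
    ((if a \<in> moves b then var (xs ! a) * rotated (b(p := a)) else 0) +
     (if Suc a \<in> moves b then var (xs ! Suc a) * rotated (b(p := Suc a)) else 0))"
proof -
  let ?f = "\<lambda>e. var (xs ! e) * rotated (b(p := e))"
  have "sum ?f (moves b) = sum ?f (moves b - {a, Suc a}) + sum ?f (moves b \<inter> {a, Suc a})"
    by (subst sum.union_disjoint[symmetric]) (auto intro: sum.cong)
  moreover have "sum ?f (moves b \<inter> {a, Suc a}) = (if a \<in> moves b then ?f a else 0) + (if Suc a \<in> moves b then ?f (Suc a) else 0)"
    by (cases "a \<in> moves b"; cases "Suc a \<in> moves b") simp_all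
  ultimately show ?thesis
    by simp
qed

lemma targets_swp:
  assumes "b p \<noteq> a" "b p \<noteq> Suc a"
  shows "moves (swp a b) - {a, Suc a} = moves b - {a, Suc a}"
proof -
  have "swp a b r = e \<longleftrightarrow> b r = e" "e \<le> swp a b r \<longleftrightarrow> e \<le> b r"
    "swp a b r \<le> swp a b p \<longleftrightarrow> b r \<le> b p" if "e \<noteq> a" "e \<noteq> Suc a" for e r
    using assms that unfolding swp_apply by auto
  then show ?thesis
    unfolding targets_def by blast
qed

definition adjacent_part :: "(nat \<Rightarrow> nat) \<Rightarrow> 'v mpoly" where
  "adjacent_part b = (if a \<in> moves b then var (xs ! a) * rotated (b(p := a)) else 0) +
     (if Suc a \<in> moves b then var (xs ! Suc a) * rotated (b(p := Suc a)) else 0)"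

text \<open>A box labelled neither \<open>a\<close> nor \<open>Suc a\<close> contributes a variable
  fixed by the swap, so these terms can be compared one by one. The other two form
  \<open>adjacent_part\<close> and are treated as a whole.\<close>

lemma move_divdiff:
  assumes b: "adm b" and moves: "moves c - {a, Suc a} = moves b - {a, Suc a}"
    and "\<And>e. e \<in> moves b \<Longrightarrow> e \<noteq> a \<Longrightarrow> e \<noteq> Suc a \<Longrightarrow> divdiff (rotated (b(p := e))) (rotated (c(p := e)))"
    and "divdiff (adjacent_part b) (adjacent_part c)"
  shows "divdiff (gen_poly xs ((p, Suc k) # q) b) (gen_poly xs ((p, Suc k) # q) c)"
  unfolding gen_poly_split moves adjacent_part_def[symmetric]
  by (intro is_divdiff_add is_divdiff_sum divdiff_mult_var[OF b] assms) auto

lemma move_divdiff_add: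
  assumes b: "adm b" and moves: "moves c - {a, Suc a} = moves b - {a, Suc a}"
    and "\<And>e. e \<in> moves b \<Longrightarrow> e \<noteq> a \<Longrightarrow> e \<noteq> Suc a \<Longrightarrow> divdiff (rotated (b(p := e))) (rotated (b(p := e)) + rotated (c(p := e)))"
    and "divdiff (adjacent_part b) (adjacent_part b + adjacent_part c)"
  shows "divdiff (gen_poly xs ((p, Suc k) # q) b)
    (gen_poly xs ((p, Suc k) # q) b + gen_poly xs ((p, Suc k) # q) c)"
proof -
  let ?f = "\<lambda>b e. var (xs ! e) * rotated (b(p := e))"
  have "divdiff (sum (?f b) (moves b - {a, Suc a}) + adjacent_part b)
    ((\<Sum>e\<in>moves b - {a, Suc a}. ?f b e + ?f c e) + (adjacent_part b + adjacent_part c))"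
    unfolding distrib_left[symmetric]
    by (intro is_divdiff_add is_divdiff_sum divdiff_mult_var[OF b] assms) auto
  then show ?thesis
    unfolding gen_poly_split moves adjacent_part_def[symmetric] by (simp add: sum.distrib algebra_simps)
qed

lemma move_absent:
  assumes b: "adm b" and absent: "\<And>r. r \<in> insert p (names q) \<Longrightarrow> b r \<noteq> a \<and> b r \<noteq> Suc a"
  shows "divdiff (gen_poly xs ((p, Suc k) # q) b) (gen_poly xs ((p, Suc k) # q) b)"
proof (rule move_divdiff[OF b refl])
  fix e assume "e \<in> moves b" "e \<noteq> a" "e \<noteq> Suc a"
  then show "divdiff (rotated (b(p := e))) (rotated (b(p := e)))"
    using absent by (intro exchangeD(1) IH adm_upd[OF b]) auto
next
  have moves: "a \<in> moves b \<longleftrightarrow> Suc a \<in> moves b"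
  proof -
    have "b r \<noteq> a \<and> b r \<noteq> Suc a" "a \<le> b r \<longleftrightarrow> Suc a \<le> b r" if "r \<in> insert p (names q)" for r
      using absent[OF that] by auto
    then show ?thesis
      unfolding targets_def by auto
  qed
  show "divdiff (adjacent_part b) (adjacent_part b)"
  proof (cases "a \<in> moves b")
    case True
    have "divdiff (rotated (b(p := a))) (rotated (swp a (b(p := a))))"
      using adm_upd[OF b True] absent by (intro exchangeD(2)[of _ _ _ _ p] IH) auto
    also have "rotated (swp a (b(p := a))) = rotated (b(p := Suc a))"
      using absent by (intro gen_poly_cong) (auto simp: swp_apply)
    finally have "divdiff (rotated (b(p := a))) (rotated (b(p := Suc a)))" .
    \<comment> \<open>By the product rule both terms together are the value of the operator at
      \<open>var (xs ! a) * rotated (b(p := a))\<close>, hence fixed by it.\<close>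
    from is_divdiff_idem[OF adjacent_distinct is_divdiff_var_add[OF this]] show ?thesis
      using True moves by (simp add: adjacent_part_def)
  next
    case False
    with moves show ?thesis
      by (simp add: adjacent_part_def is_divdiff_0)
  qed
qed

lemma move_single_other:
  assumes b: "adm b" and P: "P \<in> names q" "b P = a" and absent: "\<And>r. r \<in> insert p (names q) \<Longrightarrow> b r \<noteq> Suc a"
  shows "divdiff (gen_poly xs ((p, Suc k) # q) b) (gen_poly xs ((p, Suc k) # q) (swp a b))"
proof -
  have neq: "b r \<noteq> a" if "r \<in> insert p (names q)" "r \<noteq> P" for r
    using admissible_eqD[OF b, of r P] that P by auto
  have "p \<noteq> P"
    using P p_notin by auto
  show ?thesis
  proof (rule move_divdiff[OF b targets_swp])
    fix e assume e: "e \<in> moves b" "e \<noteq> a" "e \<noteq> Suc a"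
    then show "divdiff (rotated (b(p := e))) (rotated ((swp a b)(p := e)))"
      unfolding swp_upd[OF e(2,3)]
      using absent P \<open>p \<noteq> P\<close> by (intro exchangeD(2)[of _ _ _ _ P] IH adm_upd[OF b]) auto
  next
    have a_b: "a \<notin> moves b"
      using P by (intro not_target)
    have a'_c: "Suc a \<notin> moves (swp a b)"
      using P by (intro not_target[of P]) (auto simp: swp_apply)
    \<comment> \<open>After the exchange \<open>P\<close> sits at \<open>Suc a\<close>, and
      \<open>p\<close> has to pass it to reach \<open>a\<close>; only a column smaller than
      \<open>p\<close> forbids this.\<close>
    have a_c: "a \<in> moves (swp a b) \<longleftrightarrow> Suc a \<in> moves b \<and> p < P"
    proof -
      have swp: "swp a b r = b r" "b r \<noteq> a" "b r \<noteq> Suc a" "a \<le> b r \<longleftrightarrow> Suc a \<le> b r"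
        if "r \<in> insert p (names q)" "r \<noteq> P" for r
        using absent[OF that(1)] neq[OF that] by (auto simp: swp_apply)
      have swpP: "swp a b P = Suc a"
        using P by (simp add: swp_apply)
      have swpp: "swp a b p = b p"
        using swp(1)[of p] \<open>p \<noteq> P\<close> by simp
      have "swp a b r \<noteq> a" if "r \<in> names q" for r
        using that swp(1,2)[of r] swpP by (cases "r = P") auto
      moreover have "a \<le> b p \<longleftrightarrow> Suc a \<le> b p"
        using swp(4)[of p] \<open>p \<noteq> P\<close> by simp
      ultimately have "a \<in> moves (swp a b) \<longleftrightarrow> Suc a \<le> b p \<and>
          (\<forall>r\<in>names q. r < p \<longrightarrow> \<not> (a \<le> swp a b r \<and> swp a b r \<le> b p))"
        unfolding targets_def swpp by simp
      also have "\<dots> \<longleftrightarrow> Suc a \<le> b p \<and>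
          (\<forall>r\<in>names q. r < p \<longrightarrow> r \<noteq> P \<and> \<not> (Suc a \<le> b r \<and> b r \<le> b p))"
      proof (intro conj_cong refl ball_cong imp_cong)
        fix r assume "Suc a \<le> b p" "r \<in> names q"
        then show "(\<not> (a \<le> swp a b r \<and> swp a b r \<le> b p)) \<longleftrightarrow>
            r \<noteq> P \<and> \<not> (Suc a \<le> b r \<and> b r \<le> b p)"
          using swp(1,4)[of r] swpP by (cases "r = P") auto
      qed
      also have "\<dots> \<longleftrightarrow> Suc a \<in> moves b \<and> p < P"
        using absent P \<open>p \<noteq> P\<close> unfolding targets_def by auto
      finally show ?thesis .
    qed
    consider "Suc a \<notin> moves b" | "Suc a \<in> moves b" "p < P" | "Suc a \<in> moves b" "P < p"
      using \<open>p \<noteq> P\<close> by linarith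
    then show "divdiff (adjacent_part b) (adjacent_part (swp a b))"
    proof cases
      case 1
      then show ?thesis
        using a_b a'_c a_c by (simp add: adjacent_part_def is_divdiff_0)
    next
      case 2
      have "divdiff (rotated (b(p := Suc a))) (rotated (b(p := Suc a)) + rotated (swp a (b(p := Suc a))))"
        using 2 P \<open>p \<noteq> P\<close> adm_upd[OF b 2(1)] by (intro exchangeD(4)[of _ _ _ _ P p] IH) (auto simp: before_append)
      also have "swp a (b(p := Suc a)) = (swp a b)(p := a)"
        by (auto simp: swp_apply)
      finally have "divdiff (var (xs ! Suc a) * rotated (b(p := Suc a))) (var (xs ! a) * rotated ((swp a b)(p := a)))"
        by (rule is_divdiff_var_shift)
      then show ?thesis
        using a_b a'_c a_c 2 by (simp add: adjacent_part_def)
    next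
      case 3
      \<comment> \<open>In \<open>?v\<close> the larger column carries the larger label, so its
        polynomial is a value of the operator, hence symmetric, and its product with the variable of
        \<open>Suc a\<close> is annihilated. This matches the blocked move on the other
        side.\<close>
      let ?v = "b(p := Suc a)"
      have "divdiff (rotated (swp a ?v)) (rotated (swp a (swp a ?v)))"
        using 3 P \<open>p \<noteq> P\<close> adm_swp[OF adm_upd[OF b 3(1)]]
        by (intro exchangeD(3)[of _ _ _ _ P p] IH) (auto simp: before_append swp_apply)
      then have "divdiff (rotated (swp a ?v)) (rotated ?v)"
        by simp
      then have "divdiff (var (xs ! Suc a) * rotated (b(p := Suc a))) 0"
        by (intro is_divdiff_var_annihilates[OF adjacent_distinct] is_divdiff_idem[OF adjacent_distinct])
      then show ?thesis
        using a_b a'_c a_c 3 by (simp add: adjacent_part_def)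
    qed
  qed (use neq[of p] absent[of p] \<open>p \<noteq> P\<close> in auto)
qed

text \<open>Over \<open>swp a b\<close> the head may stay at \<open>Suc a\<close> or step down to
  \<open>a\<close>; the two terms are the summands of the product rule
  \<open>is_divdiff_var_add\<close>.\<close>

lemma move_single_head:
  assumes b: "adm b" and P: "b p = a" and absent: "\<And>r. r \<in> insert p (names q) \<Longrightarrow> b r \<noteq> Suc a"
  shows "divdiff (gen_poly xs ((p, Suc k) # q) b) (gen_poly xs ((p, Suc k) # q) (swp a b))"
proof -
  have neq: "b r \<noteq> a" "b r \<noteq> Suc a" "swp a b r = b r" if "r \<in> names q" for r
    using admissible_eqD[OF b, of r p] that P p_notin absent[of r] by (auto simp: swp_apply)
  have swp_p: "swp a b p = Suc a"
    using P by (simp add: swp_apply)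
  have le: "b r \<le> Suc a \<longleftrightarrow> b r \<le> a" "a \<le> b r \<longleftrightarrow> Suc a \<le> b r" if "r \<in> names q" for r
    using neq[OF that] by auto
  show ?thesis
  proof (rule move_divdiff[OF b])
    have "e \<in> moves (swp a b) \<longleftrightarrow> e \<in> moves b" if "e \<noteq> Suc a" for e
      using that unfolding targets_def swp_p P by (auto simp: neq le)
    then show "moves (swp a b) - {a, Suc a} = moves b - {a, Suc a}"
      by auto
  next
    fix e assume e: "e \<in> moves b" "e \<noteq> a" "e \<noteq> Suc a"
    have "divdiff (rotated (b(p := e))) (rotated (b(p := e)))"
      using e neq by (intro exchangeD(1) IH adm_upd[OF b]) auto
    also have "rotated (b(p := e)) = rotated ((swp a b)(p := e))"
      using neq by (intro gen_poly_cong) auto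
    finally show "divdiff (rotated (b(p := e))) (rotated ((swp a b)(p := e)))" 
      using \<open>rotated (b(p := e)) = rotated ((swp a b)(p := e))\<close> by simp
  next
    have "a \<in> moves b" "Suc a \<notin> moves b" "Suc a \<in> moves (swp a b)"
      using own_target[OF b] own_target[OF adm_swp[OF b]] P swp_p by (auto simp: targets_def)
    moreover have "a \<in> moves (swp a b)"
      using neq le by (auto simp: targets_def swp_p)
    moreover have "divdiff (rotated (b(p := a))) (rotated ((swp a b)(p := Suc a)))"
    proof -
      have "b(p := a) = b" "(swp a b)(p := Suc a) = swp a b"
        using P swp_p by auto
      moreover have "divdiff (rotated b) (rotated (swp a b))"
        using b P absent by (intro exchangeD(2)[of _ _ _ _ p] IH) auto
      ultimately show ?thesis
        by simp
    qed
    moreover have "rotated ((swp a b)(p := a)) = rotated (b(p := a))"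
      using neq by (intro gen_poly_cong) auto
    ultimately show "divdiff (adjacent_part b) (adjacent_part (swp a b))"
      by (simp add: adjacent_part_def is_divdiff_var_add)
  qed
qed

lemma move_pair_other:
  assumes b: "adm b" and PR: "b P = a" "b R = Suc a" "P \<in> names q" "R \<in> names q"
  shows "R < P \<Longrightarrow> before R P q \<Longrightarrow>
      divdiff (gen_poly xs ((p, Suc k) # q) b) (gen_poly xs ((p, Suc k) # q) (swp a b))"
    and "R < P \<Longrightarrow> before P R q \<Longrightarrow> divdiff (gen_poly xs ((p, Suc k) # q) b)
      (gen_poly xs ((p, Suc k) # q) b + gen_poly xs ((p, Suc k) # q) (swp a b))"
proof -
  have neq: "p \<noteq> P" "p \<noteq> R" "b p \<noteq> a" "b p \<noteq> Suc a"
    using PR p_notin admissible_eqD[OF b, of p P] admissible_eqD[OF b, of p R] by auto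
  have "a \<notin> moves b" "Suc a \<notin> moves b" "a \<notin> moves (swp a b)" "Suc a \<notin> moves (swp a b)"
    using PR not_target[of P b] not_target[of R b] not_target[of P "swp a b"] not_target[of R "swp a b"]
    by (auto simp: swp_apply)
  then have adjacent_part: "adjacent_part b = 0" "adjacent_part (swp a b) = 0"
    by (auto simp: adjacent_part_def)
  show "divdiff (gen_poly xs ((p, Suc k) # q) b) (gen_poly xs ((p, Suc k) # q) (swp a b))"
    if "R < P" "before R P q"
  proof (rule move_divdiff[OF b targets_swp])
    fix e assume e: "e \<in> moves b" "e \<noteq> a" "e \<noteq> Suc a"
    then show "divdiff (rotated (b(p := e))) (rotated ((swp a b)(p := e)))"
      unfolding swp_upd[OF e(2,3)]
      using PR that neq by (intro exchangeD(3)[of _ _ _ _ R P] IH adm_upd[OF b]) (auto simp: before_append)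
  qed (use neq adjacent_part is_divdiff_0 in auto)
  show "divdiff (gen_poly xs ((p, Suc k) # q) b)
      (gen_poly xs ((p, Suc k) # q) b + gen_poly xs ((p, Suc k) # q) (swp a b))"
    if "R < P" "before P R q"
  proof (rule move_divdiff_add[OF b targets_swp])
    fix e assume e: "e \<in> moves b" "e \<noteq> a" "e \<noteq> Suc a"
    then show "divdiff (rotated (b(p := e))) (rotated (b(p := e)) + rotated ((swp a b)(p := e)))"
      unfolding swp_upd[OF e(2,3)]
      using PR that neq by (intro exchangeD(4)[of _ _ _ _ P R] IH adm_upd[OF b]) (auto simp: before_append)
  qed (use neq adjacent_part is_divdiff_0 in auto)
qed

text \<open>If \<open>p\<close> keeps \<open>Suc a\<close>, it is then read after \<open>P\<close>,
  where the relation is the one for \<xi> - 1; the new variable turns it back into one for \<xi>. If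
  \<open>p\<close> descends further, which the larger column \<open>P\<close> does not prevent,
  \<open>P\<close> is left as the only column with one of the two labels.\<close>

lemma move_pair_smaller_head:
  assumes b: "adm b" and P: "b P = a" "b p = Suc a" "p < P" "P \<in> names q"
  shows "divdiff (gen_poly xs ((p, Suc k) # q) b) (gen_poly xs ((p, Suc k) # q) (swp a b))"
proof -
  have neq: "b r \<noteq> a" "b r \<noteq> Suc a" "swp a b r = b r" if "r \<in> names q" "r \<noteq> P" for r
    using admissible_eqD[OF b, of r p] admissible_eqD[OF b, of r P] that P p_notin by (auto simp: swp_apply)
  have swp: "swp a b p = a" "swp a b P = Suc a"
    using P by (simp_all add: swp_apply)
  have le: "b r \<le> Suc a \<longleftrightarrow> b r \<le> a" if "r \<in> names q" "r \<noteq> P" for r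
    using neq[OF that] by auto
  have moves: "moves (swp a b) - {a, Suc a} = moves b - {a, Suc a}"
  proof -
    have "e \<in> moves (swp a b) \<longleftrightarrow> e \<in> moves b" if "e \<noteq> a" "e \<noteq> Suc a" for e
    proof -
      have "(\<forall>r\<in>names q. swp a b r \<noteq> e) \<longleftrightarrow> (\<forall>r\<in>names q. b r \<noteq> e)"
        using that by (auto simp: swp_apply)
      moreover have "(\<forall>r\<in>names q. r < p \<longrightarrow> \<not> (e \<le> swp a b r \<and> swp a b r \<le> a)) \<longleftrightarrow>
          (\<forall>r\<in>names q. r < p \<longrightarrow> \<not> (e \<le> b r \<and> b r \<le> Suc a))"
        using P neq le by (intro ball_cong refl imp_cong) auto
      moreover have "e \<le> a \<longleftrightarrow> e \<le> Suc a"
        using that by auto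
      ultimately show ?thesis
        unfolding targets_def swp P by simp
    qed
    then show ?thesis
      by auto
  qed
  show ?thesis
  proof (rule move_divdiff[OF b moves])
    fix e assume e: "e \<in> moves b" "e \<noteq> a" "e \<noteq> Suc a"
    have "b r \<noteq> Suc a" if "r \<in> names q" for r
      using neq[OF that] P by (cases "r = P") auto
    with e show "divdiff (rotated (b(p := e))) (rotated ((swp a b)(p := e)))"
      unfolding swp_upd[OF e(2,3)]
      using P by (intro exchangeD(2)[of _ _ _ _ P] IH adm_upd[OF b]) auto
  next
    have "a \<notin> moves b" "Suc a \<in> moves b" "a \<in> moves (swp a b)" "Suc a \<notin> moves (swp a b)"
      using own_target[OF b] own_target[OF adm_swp[OF b]] not_target[of P b] not_target[of P "swp a b"] P swp by auto
    moreover have "divdiff (rotated b) (rotated b + rotated (swp a b))"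
      using b P by (intro exchangeD(4)[of _ _ _ _ P p] IH) (auto simp: before_append)
    then have "divdiff (var (xs ! Suc a) * rotated b) (var (xs ! a) * rotated (swp a b))"
      by (rule is_divdiff_var_shift)
    moreover have "b(p := Suc a) = b" "(swp a b)(p := a) = swp a b"
      using P swp by auto
    ultimately show "divdiff (adjacent_part b) (adjacent_part (swp a b))"
      by (simp add: adjacent_part_def)
  qed
qed

text \<open>After the exchange the smaller column \<open>R\<close> sits just below \<open>p\<close>
  and blocks every descent, so a single term is left. Before it \<open>p\<close> may descend below
  \<open>a\<close>, and these terms are fixed by the operator; this is why the polynomial of
  \<open>b\<close> reappears as a summand.\<close>

lemma move_pair_larger_head:
  assumes b: "adm b" and R: "b p = a" "b R = Suc a" "R < p" "R \<in> names q"
  shows "divdiff (gen_poly xs ((p, Suc k) # q) b)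
    (gen_poly xs ((p, Suc k) # q) b + gen_poly xs ((p, Suc k) # q) (swp a b))"
proof -
  have swp: "swp a b p = Suc a" "swp a b R = a"
    using R by (simp_all add: swp_apply)
  have neq: "b r \<noteq> a" "b r \<noteq> Suc a" if "r \<in> names q" "r \<noteq> R" for r
    using admissible_eqD[OF b, of r p] admissible_eqD[OF b, of r R] that R p_notin by auto
  have Tc: "moves (swp a b) = {Suc a}"
  proof
    show "moves (swp a b) \<subseteq> {Suc a}"
    proof
      fix e assume "e \<in> moves (swp a b)"
      then have "e \<le> Suc a" "\<not> (e \<le> a \<and> a \<le> Suc a)"
        using R swp unfolding targets_def by auto
      then show "e \<in> {Suc a}"
        by simp
    qed
  qed (use own_target[OF adm_swp[OF b]] swp in simp)
  have Tb: "a \<in> moves b" "Suc a \<notin> moves b"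
    using own_target[OF b] R by (auto simp: targets_def)
  have id: "b(p := a) = b" "(swp a b)(p := Suc a) = swp a b"
    using R swp by auto
  have c: "gen_poly xs ((p, Suc k) # q) (swp a b) = var (xs ! Suc a) * rotated (swp a b)"
    by (simp add: Tc id)
  have bsplit: "gen_poly xs ((p, Suc k) # q) b =
      (\<Sum>e\<in>moves b - {a, Suc a}. var (xs ! e) * rotated (b(p := e))) + var (xs ! a) * rotated b"
    unfolding gen_poly_split using Tb id by simp
  have "divdiff (rotated b) (rotated (swp a b))"
    using b R by (intro exchangeD(3)[of _ _ _ _ R p] IH) (auto simp: before_append)
  then have "divdiff (var (xs ! a) * rotated b) (var (xs ! a) * rotated b + var (xs ! Suc a) * rotated (swp a b))"
    by (rule is_divdiff_var_add)
  \<comment> \<open>Once \<open>p\<close> has left, \<open>R\<close> alone carries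
    \<open>Suc a\<close>; the polynomial is the value of the operator for \<open>R\<close> carrying
    \<open>a\<close>, hence fixed.\<close>
  moreover have "divdiff (rotated (b(p := e))) (rotated (b(p := e)))" if e: "e \<in> moves b" "e \<noteq> a" "e \<noteq> Suc a" for e
  proof -
    let ?v = "b(p := e)"
    have v: "?v r \<noteq> a" if "r \<in> insert p (names q)" for r
      using that neq[of r] R e by (cases "r = R") auto
    have "divdiff (rotated (swp a ?v)) (rotated (swp a (swp a ?v)))"
      using R e v by (intro exchangeD(2)[of _ _ _ _ R] IH adm_swp adm_upd[OF b]) (auto simp: swp_apply)
    then have "divdiff (rotated (swp a ?v)) (rotated ?v)"
      by simp
    then show ?thesis
      by (rule is_divdiff_idem[OF adjacent_distinct])
  qed
  ultimately show ?thesis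
    unfolding c bsplit add.assoc
    by (intro is_divdiff_add is_divdiff_sum divdiff_mult_var[OF b]) auto
qed

lemma exchange_move:
  assumes b: "adm b"
  shows "exchange xs a ((p, Suc k) # q) b"
  unfolding exchange_def
proof (intro conjI allI ballI impI; (elim conjE)?)
  assume "\<forall>r\<in>names ((p, Suc k) # q). b r \<noteq> a \<and> b r \<noteq> Suc a"
  then show "divdiff (gen_poly xs ((p, Suc k) # q) b) (gen_poly xs ((p, Suc k) # q) b)"
    by (intro move_absent[OF b]) auto
next
  fix P assume "P \<in> names ((p, Suc k) # q)" "b P = a" "\<forall>r\<in>names ((p, Suc k) # q). b r \<noteq> Suc a"
  then have P: "P \<in> insert p (names q)" "b P = a" and "\<And>r. r \<in> insert p (names q) \<Longrightarrow> b r \<noteq> Suc a"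
    by auto
  then show "divdiff (gen_poly xs ((p, Suc k) # q) b) (gen_poly xs ((p, Suc k) # q) (swp a b))"
    using move_single_head[OF b] move_single_other[OF b, of P] by (cases "P = p") blast+
next
  fix P R assume *: "b P = a" "b R = Suc a" "R < P" "before R P ((p, Suc k) # q)"
  then have "P \<in> names q" "R = p \<and> P \<in> names q \<or> before R P q"
    by (auto simp: names_def dest: before_in)
  with * show "divdiff (gen_poly xs ((p, Suc k) # q) b) (gen_poly xs ((p, Suc k) # q) (swp a b))"
    using move_pair_smaller_head[OF b, of P] move_pair_other(1)[OF b, of P R]
    by (auto simp del: gen_poly.simps dest: before_in)
next
  fix P R assume *: "b P = a" "b R = Suc a" "R < P" "before P R ((p, Suc k) # q)"
  then have "R \<in> names q" "P = p \<and> R \<in> names q \<or> before P R q"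
    by (auto simp: names_def dest: before_in)
  with * show "divdiff (gen_poly xs ((p, Suc k) # q) b)
      (gen_poly xs ((p, Suc k) # q) b + gen_poly xs ((p, Suc k) # q) (swp a b))"
    using move_pair_larger_head[OF b, of R] move_pair_other(2)[OF b, of P R]
    by (auto simp del: gen_poly.simps dest: before_in)
qed

end

lemma exchange_gen_poly:
  fixes xs :: "'v::linorder list"
  assumes "distinct xs" "Suc a < length xs" "valid_queue q" "admissible (length xs) q b"
  shows "exchange xs a q b"
  using assms(3,4)
\<comment> \<open>Counting \<open>Suc k\<close> per entry makes the removal of an exhausted column a
  decrease too.\<close>
proof (induction "\<Sum>(p, k)\<leftarrow>q. Suc k" arbitrary: q b rule: less_induct)
  case less
  have neq: "xs ! a \<noteq> xs ! Suc a"
    using assms(1,2) by (simp add: nth_eq_iff_index_eq)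
  consider "q = []" | p q' where "q = (p, 0) # q'" | p k q' where "q = (p, Suc k) # q'"
    by (metis neq_Nil_conv not0_implies_Suc surj_pair)
  then show ?case
  proof cases
    case 1
    then show ?thesis
      using neq by (simp add: exchange_def is_divdiff_symmetric_iff)
  next
    case (2 p q')
    have "exchange xs a q' b"
      using less.prems 2 by (intro less.hyps) (auto simp: admissible_def dest: valid_queue_ConsD)
    then show ?thesis
      using less.prems exchange_remove unfolding 2 by blast
  next
    case (3 p k q')
    have valid: "valid_queue ((p, Suc k) # q')"
      using less.prems 3 by simp
    have "admissible (length xs) (q' @ [(p, k)]) b"
      using less.prems 3 by (simp add: admissible_def)
    moreover have "exchange xs a (q' @ [(p, k)]) c" if "admissible (length xs) (q' @ [(p, k)]) c" for c
      using valid_queue_rotate[OF valid] that 3 by (intro less.hyps) auto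
    ultimately show ?thesis
      unfolding 3 by (intro exchange_move[OF assms(1,2) valid])
  qed
qed

section \<open>Key polynomials as generating polynomials\<close>

text \<open>The condition on the order of the queue covers both dominant compositions and basements in which
  taller columns have smaller labels. As the labels below are all in use, no label can ever move.\<close>

lemma gen_poly_forced:
  assumes "distinct (map fst q)" "inj_on b (names q)"
    and "sorted_wrt (\<lambda>(p, k) (r, l). (b p < b r \<longrightarrow> l \<le> k) \<and> (b r < b p \<longrightarrow> k \<le> Suc l)) q"
    and "\<And>p k z. (p, k) \<in> set q \<Longrightarrow> 0 < k \<Longrightarrow> z < b p \<Longrightarrow> z \<in> b ` names q"
  shows "gen_poly xs q b = (\<Prod>(p, k)\<leftarrow>q. var (xs ! b p) ^ k)"
  using assms
proof (induction xs q b rule: gen_poly.induct)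
  case (1 xs b)
  then show ?case by simp
next
  case (2 xs p q b)
  have "z \<in> b ` names q" if r: "(r, l) \<in> set q" "0 < l" "z < b r" for r l z
  proof -
    have "z \<in> b ` names ((p, 0) # q)"
      using r 2(5)[of r l] by auto
    \<comment> \<open>Dropping \<open>p\<close> frees its label, but by the order hypothesis no
      column with boxes left to fill has a label above it.\<close>
    moreover have "\<not> b p < b r"
      using 2(4) r by auto
    ultimately show ?thesis
      using r by auto
  qed
  then show ?case
    using 2 by (simp add: inj_on_insert)
next
  case (3 xs p k q b)
  have p: "p \<notin> names q"
    using 3(2) by (auto simp: names_def)
  have "targets (names q) p b = {b p}"
  proof (intro equalityI subsetI)
    fix e assume e: "e \<in> targets (names q) p b"
    have "e \<notin> b ` names q" "e \<le> b p"
      using e by (auto simp: targets_def)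
    then show "e \<in> {b p}"
      using 3(5)[of p "Suc k" e] by auto
  next
    fix e assume "e \<in> {b p}"
    then show "e \<in> targets (names q) p b"
      using 3(3) p by (auto simp: targets_def inj_on_def)
  qed
  moreover have "gen_poly xs (q @ [(p, k)]) (b(p := b p)) = (\<Prod>(p, k)\<leftarrow>q @ [(p, k)]. var (xs ! b p) ^ k)"
  proof (subst 3(1))
    show "b p \<in> targets (names q) p b"
      using calculation by simp
    show "distinct (map fst (q @ [(p, k)]))"
      using 3(2) by auto
    show "inj_on (b(p := b p)) (names (q @ [(p, k)]))"
      using 3(3) by (simp add: Un_commute)
    \<comment> \<open>Rotation interchanges the two clauses: the bound with \<open>Suc\<close>
      becomes the exact one because the head has lost a box.\<close>
    show "sorted_wrt (\<lambda>(r, l) (s, j). ((b(p := b p)) r < (b(p := b p)) s \<longrightarrow> j \<le> l) \<and>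
        ((b(p := b p)) s < (b(p := b p)) r \<longrightarrow> l \<le> Suc j)) (q @ [(p, k)])"
      using 3(4) by (auto simp: sorted_wrt_append)
    show "z \<in> (b(p := b p)) ` names (q @ [(p, k)])"
      if "(r, l) \<in> set (q @ [(p, k)])" "0 < l" "z < (b(p := b p)) r" for r l z
      using 3(5)[of r "if r = p then Suc k else l" z] that p by (auto simp: names_def split: if_splits)
  qed simp
  ultimately show ?case
    by (simp add: mult_ac)
qed

lemma gen_poly_dominant:
  assumes "sorted_wrt (\<ge>) (map snd q)" "\<And>i. i < length q \<Longrightarrow> b (fst (q ! i)) = i" 
  shows "gen_poly xs q b = (\<Prod>i<length q. var (xs ! i) ^ snd (q ! i))"
proof -
  have in_names: "\<exists>i<length q. r = fst (q ! i)" if "r \<in> names q" for r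
    using that unfolding names_def by (metis imageE in_set_conv_nth)
  have "gen_poly xs q b = (\<Prod>(p, k)\<leftarrow>q. var (xs ! b p) ^ k)"
  proof (rule gen_poly_forced)
    show "distinct (map fst q)"
      unfolding distinct_conv_nth using assms(2) by (metis length_map nth_map)
    show "inj_on b (names q)"
      using assms(2) in_names unfolding inj_on_def by metis
    show "sorted_wrt (\<lambda>(p, k) (r, l). (b p < b r \<longrightarrow> l \<le> k) \<and> (b r < b p \<longrightarrow> k \<le> Suc l)) q"
      using assms unfolding sorted_wrt_iff_nth_less by (auto simp: split_beta)
    show "z \<in> b ` names q" if pkz: "(p, k) \<in> set q" "0 < k" "z < b p" for p k z
    proof -
      obtain i where "i < length q" "p = fst (q ! i)"
        using pkz(1) unfolding in_set_conv_nth by (metis fst_conv)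
      then have "z < length q" "b (fst (q ! z)) = z"
        using assms(2) pkz by auto
      then show ?thesis
        by (metis image_eqI names_def nth_mem)
    qed
  qed
  also have "\<dots> = (\<Prod>i<length q. case q ! i of (p, k) \<Rightarrow> var (xs ! b p) ^ k)"
    by (subst prod.list_conv_set_nth) (simp add: lessThan_atLeast0)
  finally show ?thesis
    using assms(2) by (simp add: split_beta)
qed

lemma gen_poly_antitone:
  assumes "valid_queue q" "inj_on b (names q)" "b ` names q = {..<length xs}"
    and anti: "\<And>r s. r \<in> names q \<Longrightarrow> s \<in> names q \<Longrightarrow> r < s \<Longrightarrow> b s < b r"
  shows "gen_poly xs q b = (\<Prod>(p, k)\<leftarrow>q. var (xs ! b p) ^ k)"
proof (rule gen_poly_forced)
  show "distinct (map fst q)"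
    using assms(1) by (simp add: valid_queue_def)
  have *: "sorted_wrt (\<lambda>(p, k) (r, l). p < r \<longleftrightarrow> k \<le> l) q"
    using assms(1) by (simp add: valid_queue_def)
  show "sorted_wrt (\<lambda>(p, k) (r, l). (b p < b r \<longrightarrow> l \<le> k) \<and> (b r < b p \<longrightarrow> k \<le> Suc l)) q"
  proof (rule sorted_wrt_mono_rel[OF _ *], clarify)
    fix p k r l assume "(p, k) \<in> set q" "(r, l) \<in> set q" and less: "p < r \<longleftrightarrow> k \<le> l"
    then have pr: "p \<in> names q" "r \<in> names q"
      by (force simp: names_def)+
    show "(b p < b r \<longrightarrow> l \<le> k) \<and> (b r < b p \<longrightarrow> k \<le> Suc l)"
      using anti[OF pr] anti[OF pr(2,1)] less by (cases p r rule: linorder_cases) auto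
  qed
  show "z \<in> b ` names q" if "(p, k) \<in> set q" "0 < k" "z < b p" for p k z
  proof -
    have "b p \<in> b ` names q"
      using that(1) by (force simp: names_def)
    then show ?thesis
      using that(3) assms(3) by auto
  qed
qed (use assms in auto)

lemma swp_less: "b p < b r \<Longrightarrow> \<not> (b p = a \<and> b r = Suc a) \<Longrightarrow> swp a b p < swp a b r"
  by (auto simp: swp_apply)

text \<open>As the labels fill an initial segment, the inverse of \<open>b\<close> is a finite
  sequence of columns, and it decreases once each of its steps does.\<close>

lemma antitone_if_adjacent:
  assumes inj: "inj_on b A" and img: "b ` A = {..<n :: nat}"
    and adj: "\<And>M N. M \<in> A \<Longrightarrow> N \<in> A \<Longrightarrow> b N = Suc (b M) \<Longrightarrow> N < (M :: nat)"
    and rs: "r \<in> A" "s \<in> A" "r < s"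
  shows "b s < b r"
proof (rule ccontr)
  define g where "g = inv_into A b"
  have g: "g i \<in> A" "b (g i) = i" if "i < n" for i
    using that img unfolding g_def by (auto intro: inv_into_into f_inv_into_f)
  have step: "g (Suc i) < g i" if "Suc i < n" for i
    using adj[of "g i" "g (Suc i)"] g[of i] g[of "Suc i"] that by simp
  have decr: "i < j \<Longrightarrow> j < n \<Longrightarrow> g j < g i" for i j
  proof (induction j)
    case (Suc j)
    then show ?case
      using step[of j] by (cases "i = j") (auto intro: less_trans)
  qed simp
  assume "\<not> b s < b r"
  moreover have "b r \<noteq> b s"
    using inj rs by (auto simp: inj_on_def)
  moreover have "b s < n" "g (b r) = r" "g (b s) = s"
    using img inj rs by (auto simp: g_def)
  ultimately show False
    using decr[of "b r" "b s"] rs by simp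
qed

text \<open>The induction undoes exchanges of adjacent labels until larger columns have smaller labels. It never
  exchanges the labels of \<open>P\<close> and \<open>R\<close>, whose order is already the final one, so both sides obey the same
  relations.\<close>

lemma gen_poly_swap_adjacent:
  fixes xs :: "'v::linorder list"
  assumes xs: "distinct xs"
    and valid: "valid_queue (u @ (P, k) # (R, l) # v)" "valid_queue (u @ (R, l) # (P, k) # v)"
    and less: "R < P"
    and "inj_on b (names (u @ (P, k) # (R, l) # v))"
    and "b ` names (u @ (P, k) # (R, l) # v) = {..<length xs}"
    and "b P < b R"
  shows "gen_poly xs (u @ (P, k) # (R, l) # v) b = gen_poly xs (u @ (R, l) # (P, k) # v) b"
  using assms(5-7)
\<comment> \<open>The sum drops by \<open>N - M\<close> when the larger of two adjacent labels
  passes from \<open>N\<close> to the smaller column \<open>M\<close>.\<close>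
proof (induction "\<Sum>m\<in>names (u @ (P, k) # (R, l) # v). b m * m" arbitrary: b rule: less_induct)
  case less
  let ?q = "u @ (P, k) # (R, l) # v" and ?q' = "u @ (R, l) # (P, k) # v"
  have names: "names ?q' = names ?q"
    by auto
  have adm: "admissible (length xs) ?q b"
    using less.prems by (auto simp: admissible_def simp del: names_simps)
  show ?case
  proof (cases "\<exists>M\<in>names ?q. \<exists>N\<in>names ?q. M < N \<and> b N = Suc (b M)")
    case True
    then obtain M N where MN: "M \<in> names ?q" "N \<in> names ?q" "M < N" "b N = Suc (b M)"
      by blast
    define c where "c = swp (b M) b"
    have len: "Suc (b M) < length xs"
      using MN adm by (metis admissible_def)
    have c_inj: "inj_on c (names ?q)"
      using less.prems(1) unfolding c_def inj_on_def swp_apply by (auto simp del: names_simps split: if_splits)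
    have c_less: "c r < length xs" if "r \<in> names ?q" for r
      using adm that len unfolding c_def admissible_def swp_apply by (auto simp del: names_simps)
    have card: "card (c ` names ?q) = card {..<length xs}"
      using c_inj less.prems(1,2) by (metis card_image)
    have c_img: "c ` names ?q = {..<length xs}"
      using c_less card by (intro card_subset_eq) (auto simp del: names_simps)
    have neqs: "\<not> (b P = b M \<and> b R = Suc (b M))"
    proof
      assume "b P = b M \<and> b R = Suc (b M)"
      then have "P = M" "R = N"
        using admissible_eqD[OF adm, of P M] admissible_eqD[OF adm, of R N] MN by auto
      then show False
        using MN \<open>R < P\<close> by simp
    qed
    have c_PR: "c P < c R"
      unfolding c_def using less.prems(3) neqs by (rule swp_less)
    have "(\<Sum>m\<in>names ?q. c m * m) < (\<Sum>m\<in>names ?q. b m * m)"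
    proof -
      have split: "(\<Sum>m\<in>names ?q. f m) = f M + (f N + sum f (names ?q - {M, N}))" for f :: "nat \<Rightarrow> nat"
        using MN by (subst sum.remove[of _ M], simp_all del: names_simps, subst sum.remove[of _ N])
          (auto simp del: names_simps simp: Diff_insert2[symmetric] insert_commute)
      have "sum (\<lambda>m. c m * m) (names ?q - {M, N}) = sum (\<lambda>m. b m * m) (names ?q - {M, N})"
      proof (rule sum.cong[OF refl])
        fix m assume m: "m \<in> names ?q - {M, N}"
        then have "b m \<noteq> b M" "b m \<noteq> b N"
          using admissible_eqD[OF adm, of m] MN by blast+
        then show "c m * m = b m * m"
          using MN by (simp add: c_def swp_apply)
      qed
      moreover have "c M = Suc (b M)" "c N = b M"
        using MN by (auto simp: c_def swp_apply)
      ultimately show ?thesis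
        unfolding split using MN by (simp add: algebra_simps)
    qed
    then have IH: "gen_poly xs ?q c = gen_poly xs ?q' c"
      by (rule less.hyps[OF _ c_inj c_img c_PR])
    have "c N = b M" "c M = Suc (b M)" "swp (b M) c = b"
      using MN by (auto simp: c_def swp_apply)
    have adm_c: "admissible (length xs) ?q c" "admissible (length xs) ?q' c"
      using c_inj c_less unfolding admissible_def names by blast+
    note ex = exchange_gen_poly[OF xs len valid(1) adm_c(1)] exchange_gen_poly[OF xs len valid(2) adm_c(2)]
    have "\<not> (M = R \<and> N = P)" "\<not> (M = P \<and> N = R)"
      using MN less.prems(3) \<open>R < P\<close> by auto
    \<comment> \<open>\<open>P\<close> and \<open>R\<close> are the only two columns read in
      different orders in the two queues.\<close>
    then have before: "before M N ?q \<longleftrightarrow> before M N ?q'" "before N M ?q \<longleftrightarrow> before N M ?q'"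
      by (auto simp: before_append)
    have neq: "xs ! b M \<noteq> xs ! Suc (b M)"
      using xs len by (simp add: nth_eq_iff_index_eq)
    show ?thesis
    \<comment> \<open>In either case the relation determines the polynomial of \<open>b\<close> from
      that of \<open>c\<close>, by uniqueness of the quotient.\<close>
    proof (cases "before M N ?q")
      case True
      then show ?thesis
        using exchangeD(3)[OF ex(1), of M N] exchangeD(3)[OF ex(2), of M N] before MN IH
          \<open>c N = b M\<close> \<open>c M = Suc (b M)\<close> \<open>swp (b M) c = b\<close> is_divdiff_unique[OF neq]
        by metis
    next
      case False
      then have "before N M ?q"
        using before_total[of M ?q N] MN by (metis less_irrefl names_def)
      then show ?thesis
        using exchangeD(4)[OF ex(1), of N M] exchangeD(4)[OF ex(2), of N M] before MN IH
          \<open>c N = b M\<close> \<open>c M = Suc (b M)\<close> \<open>swp (b M) c = b\<close> is_divdiff_unique[OF neq]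
        by (metis add_left_cancel)
    qed
  next
    case False
    have anti: "b s < b r" if "r \<in> names ?q" "s \<in> names ?q" "r < s" for r s
    proof (rule antitone_if_adjacent[OF less.prems(1,2) _ that])
      fix M N assume "M \<in> names ?q" "N \<in> names ?q" "b N = Suc (b M)"
      with False show "N < M"
        by (metis linorder_neqE_nat n_not_Suc_n)
    qed
    have "gen_poly xs ?q b = (\<Prod>(p, k)\<leftarrow>?q. var (xs ! b p) ^ k)"
      by (rule gen_poly_antitone[OF valid(1) less.prems(1,2) anti])
    moreover have "gen_poly xs ?q' b = (\<Prod>(p, k)\<leftarrow>?q'. var (xs ! b p) ^ k)"
      using less.prems(1,2) anti unfolding names[symmetric] by (intro gen_poly_antitone[OF valid(2)])
    ultimately show ?thesis
      by (simp add: mult_ac)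
  qed
qed

section \<open>The recursion of key polynomials\<close>

lemma is_key_length: "is_key xs \<alpha> f \<Longrightarrow> length \<alpha> = length xs"
  by (induction rule: is_key.induct) auto

lemma two_adjacent_split:
  "Suc i < length q \<Longrightarrow> q = take i q @ q ! i # q ! Suc i # drop (Suc (Suc i)) q"
  by (metis Cons_nth_drop_Suc Suc_lessD append_take_drop_id)

text \<open>Induction over derivations covers every order of applying the second rule, so uniqueness
  comes for free; the exchange relation exhibits the quotient that \<open>isobaric_divdiff\<close>
  selects.\<close>

lemma is_key_gen_poly:
  fixes xs :: "'v::linorder list"
  assumes "is_key xs \<alpha> f" "distinct xs" "valid_queue q" "map snd q = \<alpha>"
    and "\<And>i. i < length q \<Longrightarrow> b (fst (q ! i)) = i"
  shows "f = gen_poly xs q b"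
  using assms(1,3-5)
proof (induction arbitrary: q b rule: is_key.induct)
  case (dominant \<alpha>)
  then have "gen_poly xs q b = (\<Prod>i<length q. var (xs ! i) ^ snd (q ! i))"
    by (intro gen_poly_dominant) auto
  also have "\<dots> = (\<Prod>i<length xs. var (xs ! i) ^ \<alpha> ! i)"
    using dominant by (intro prod.cong) auto
  finally show ?case ..
next
  case (step \<alpha> f i)
  have len: "length q = length xs" "length \<alpha> = length xs"
    using is_key_length[OF step.hyps(1)] step.prems(2) by (auto dest: arg_cong[of _ _ length])
  then have i: "Suc i < length q"
    using step.hyps by simp
  obtain R l P k where RP: "q ! i = (R, l)" "q ! Suc i = (P, k)"
    by (metis surj_pair)
  define u v where "u = take i q" and "v = drop (Suc (Suc i)) q"
  have q: "q = u @ (R, l) # (P, k) # v"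
    using two_adjacent_split[OF i] unfolding u_def v_def RP .
  have lu: "length u = i"
    using i by (simp add: u_def)
  let ?q = "u @ (P, k) # (R, l) # v"
  have snd_q: "snd (q ! j) = (\<alpha>[i := \<alpha> ! Suc i, Suc i := \<alpha> ! i]) ! j" if "j < length q" for j
    using that by (simp flip: step.prems(2))
  then have kl: "k = \<alpha> ! i" "l = \<alpha> ! Suc i"
    using snd_q[of i] snd_q[of "Suc i"] RP i len by auto
  then have "l < k"
    using step.hyps by simp
  then have "R < P"
    using step.prems(1) unfolding q by (auto simp: valid_queue_def sorted_wrt_append)
  have valid: "valid_queue ?q"
    using step.prems(1) \<open>R < P\<close> \<open>l < k\<close> unfolding q
    by (auto simp: valid_queue_def sorted_wrt_append)
  have q'_nth: "?q ! j = (if j = i then (P, k) else if j = Suc i then (R, l) else q ! j)" for j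
    unfolding q using lu by (auto simp: nth_append nth_Cons split: nat.splits)
  have snd_q': "map snd ?q = \<alpha>"
  proof (rule nth_equalityI)
    show "length (map snd ?q) = length \<alpha>"
      using arg_cong[OF q, of length] len by simp
    fix j assume j: "j < length (map snd ?q)"
    then have "map snd ?q ! j = snd (?q ! j)"
      by (simp only: nth_map length_map)
    also have "\<dots> = \<alpha> ! j"
    proof -
      have "j < length q"
        using j arg_cong[OF q, of length] by simp
      then show ?thesis
        unfolding q'_nth using snd_q[of j] len kl by (simp add: nth_list_update split: if_splits)
    qed
    finally show "map snd ?q ! j = \<alpha> ! j" .
  qed
  have b_q': "swp i b (fst (?q ! j)) = j" if "j < length ?q" for j
  proof -
    have "b (fst (q ! j)) = j" "b P = Suc i" "b R = i"
      using step.prems(3)[of j] step.prems(3)[of i] step.prems(3)[of "Suc i"] that i RP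
        arg_cong[OF q, of length] by auto
    then show ?thesis
      unfolding q'_nth by (auto simp: swp_apply)
  qed
  have f: "f = gen_poly xs ?q (swp i b)"
    by (rule step.IH[OF valid snd_q' b_q'])
  have in_names: "\<exists>j<length q. r = fst (q ! j)" if "r \<in> names q" for r
    using that unfolding names_def by (metis imageE in_set_conv_nth)
  have b: "b P = Suc i" "b R = i"
    using step.prems(3)[of i] step.prems(3)[of "Suc i"] i RP by auto
  have inj_b: "inj_on b (names q)"
    using in_names step.prems(3) unfolding inj_on_def by metis
  have inj: "inj_on (swp i b) (names q)"
    using inj_b by (auto simp: inj_on_def swp_apply split: if_splits)
  have names: "names ?q = names q"
    unfolding q by auto
  have lt: "swp i b r < length xs" if r: "r \<in> names q" for r
    using in_names[OF r] step.prems(3) i len by (auto simp: swp_apply)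
  have img: "swp i b ` names q = {..<length xs}"
  proof (rule card_subset_eq)
    have "card (names q) = length q"
      using step.prems(1) distinct_card[of "map fst q"] by (simp add: names_def valid_queue_def)
    then show "card (swp i b ` names q) = card {..<length xs}"
      using len inj by (simp add: card_image)
  qed (use lt in auto)
  \<comment> \<open>The columns trade places keeping their labels, \<open>P\<close> having the
    smaller one; then the labels are exchanged over \<open>q\<close>, which applies the
    operator.\<close>
  have "gen_poly xs ?q (swp i b) = gen_poly xs q (swp i b)"
    using gen_poly_swap_adjacent[OF assms(2) valid step.prems(1)[unfolded q] \<open>R < P\<close>] inj img b
    unfolding names by (simp add: swp_apply flip: q)
  moreover have "exchange xs i q (swp i b)"
    using inj lt len i by (intro exchange_gen_poly assms(2) step.prems(1)) (auto simp: admissible_def)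
  then have "is_divdiff (xs ! i) (xs ! Suc i) (gen_poly xs q (swp i b)) (gen_poly xs q (swp i (swp i b)))"
    using b \<open>R < P\<close> by (intro exchangeD(3)[of _ _ _ _ R P]) (auto simp: swp_apply q before_append)
  moreover have "xs ! i \<noteq> xs ! Suc i"
    using assms(2) i len by (simp add: nth_eq_iff_index_eq)
  ultimately show ?case
    unfolding f by (auto intro: isobaric_divdiff_eqI)
qed

lemma is_key_exists: "length \<alpha> = length xs \<Longrightarrow> \<exists>f. is_key xs \<alpha> f"
\<comment> \<open>Undoing an ascent moves the larger entry to the left and lowers this weighted
  sum.\<close>
proof (induction "\<Sum>j<length \<alpha>. j * \<alpha> ! j" arbitrary: \<alpha> rule: less_induct)
  case less
  show ?case
  proof (cases "sorted_wrt (\<ge>) \<alpha>")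
    case True
    then show ?thesis
      using is_key.dominant[of \<alpha> xs] less.prems by blast
  next
    case False
    then obtain i where i: "Suc i < length \<alpha>" "\<alpha> ! i < \<alpha> ! Suc i"
      by (metis linorder_not_le sorted_wrt_iff_nth_Suc_transp transp_on_ge)
    let ?\<beta> = "\<alpha>[i := \<alpha> ! Suc i, Suc i := \<alpha> ! i]"
    have split: "(\<Sum>j<length \<alpha>. g j) = g i + (g (Suc i) + sum g ({..<length \<alpha>} - {i, Suc i}))" for g :: "nat \<Rightarrow> nat"
      using i by (subst sum.remove[of _ i], simp_all, subst sum.remove[of _ "Suc i"])
        (auto simp: Diff_insert2[symmetric] insert_commute)
    have "(\<Sum>j\<in>{..<length \<alpha>} - {i, Suc i}. j * ?\<beta> ! j) = (\<Sum>j\<in>{..<length \<alpha>} - {i, Suc i}. j * \<alpha> ! j)"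
      by (intro sum.cong) auto
    moreover have "i * \<alpha> ! Suc i + Suc i * \<alpha> ! i < i * \<alpha> ! i + Suc i * \<alpha> ! Suc i"
      using i by simp
    ultimately have "(\<Sum>j<length ?\<beta>. j * ?\<beta> ! j) < (\<Sum>j<length \<alpha>. j * \<alpha> ! j)"
      unfolding length_list_update split using i by simp
    then obtain f where "is_key xs ?\<beta> f"
      using less.hyps[of ?\<beta>] less.prems by auto
    from is_key.step[OF this, of i] show ?thesis
      using i by (auto simp: list_update_swap[of i "Suc i"])
  qed
qed

theorem key_poly_eq_gen_poly:
  fixes xs :: "'v::linorder list"
  assumes "distinct xs" "length q = length xs" "valid_queue q"
    and "\<And>i. i < length q \<Longrightarrow> b (fst (q ! i)) = i"
  shows "key_poly xs (map snd q) = gen_poly xs q b"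
proof -
  obtain f where "is_key xs (map snd q) f"
    using is_key_exists[of "map snd q" xs] assms(2) by auto
  moreover have "g = gen_poly xs q b" if "is_key xs (map snd q) g" for g
    using is_key_gen_poly[OF that assms(1,3) refl assms(4)] .
  ultimately show ?thesis
    unfolding key_poly_def by (metis the_equality)
qed

section \<open>From generating polynomials to fillings\<close>

text \<open>In the first row labels increase along the queue: the entries of \<open>q1\<close>
  behind the head have labels above its own, out of reach of its move. An empty column is thus
  harmless until it is read, and then it disappears. \<open>q2\<close> collects the columns already
  read.\<close>

lemma gen_poly_drop_zeros:
  assumes "sorted_wrt (\<lambda>x y. b (fst x) < b (fst y)) q1" "distinct (map fst q1)"
  shows "gen_poly xs (q1 @ q2) b = gen_poly xs (filter (\<lambda>x. snd x \<noteq> 0) q1 @ q2) b"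
  using assms
proof (induction q1 arbitrary: q2 b)
  case (Cons x q1)
  obtain p l where x: "x = (p, l)"
    by (cases x)
  show ?case
  proof (cases l)
    case 0
    then show ?thesis
      using Cons x by simp
  next
    case (Suc k)
    have p: "p \<notin> names q1"
      using Cons.prems(2) x by (auto simp: names_def)
    have gt: "b p < b r" if "r \<in> names q1" for r
      using Cons.prems(1) that x by (auto simp: names_def)
    have sub: "names (filter (\<lambda>x. snd x \<noteq> 0) q1) \<subseteq> names q1"
      by (auto simp: names_def)
    have drop: "targets (N \<union> names q2) p b = targets (names q2) p b" if "N \<subseteq> names q1" for N
    proof -
      have "b p < b r" if "r \<in> N" for r
        using gt \<open>N \<subseteq> names q1\<close> that by blast
      then have "b r \<noteq> e \<and> \<not> b r \<le> b p" if "e \<le> b p" "r \<in> N" for e r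
        using that by (metis leD)
      then show ?thesis
        unfolding targets_def ball_Un by blast
    qed
    have "targets (names (q1 @ q2)) p b = targets (names (filter (\<lambda>x. snd x \<noteq> 0) q1 @ q2)) p b"
      using drop[OF sub] drop[OF order_refl] by simp
    moreover have "gen_poly xs (q1 @ q2 @ [(p, k)]) (b(p := e)) =
        gen_poly xs (filter (\<lambda>x. snd x \<noteq> 0) q1 @ q2 @ [(p, k)]) (b(p := e))" for e
    proof (rule Cons.IH)
      show "sorted_wrt (\<lambda>x y. (b(p := e)) (fst x) < (b(p := e)) (fst y)) q1"
        using Cons.prems(1) p by (intro sorted_wrt_mono_rel[of q1, OF _ conjunct2[OF Cons.prems(1)[unfolded sorted_wrt.simps]]])
          (auto simp: names_def)
      show "distinct (map fst q1)"
        using Cons.prems(2) by simp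
    qed
    ultimately show ?thesis
      by (simp add: x Suc)
  qed
qed simp

section \<open>Choices recorded as a labelling of the diagram\<close>

definition prec :: "nat list \<Rightarrow> nat \<Rightarrow> nat \<Rightarrow> bool" where
  "prec \<mu> r c \<longleftrightarrow> \<mu> ! r < \<mu> ! c \<or> \<mu> ! r = \<mu> ! c \<and> r < c"

text \<open>All choices made by \<open>gen_poly\<close> recorded in one labelling \<open>\<tau>\<close> of the augmented diagram: the current
  label of the entry \<open>(r, l)\<close> is that of its topmost filled box \<open>(r, \<mu> ! r - l)\<close>.\<close>

function runs :: "nat list \<Rightarrow> (box \<Rightarrow> 'l::linorder) \<Rightarrow> (nat \<times> nat) list \<Rightarrow> bool" where
  "runs \<mu> \<tau> [] \<longleftrightarrow> True"
| "runs \<mu> \<tau> ((c, 0) # q) \<longleftrightarrow> runs \<mu> \<tau> q"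
| "runs \<mu> \<tau> ((c, Suc k) # q) \<longleftrightarrow>
     \<tau> (c, \<mu> ! c - k) \<le> \<tau> (c, \<mu> ! c - Suc k) \<and>
     (\<forall>(r, l) \<in> set q. \<tau> (r, \<mu> ! r - l) \<noteq> \<tau> (c, \<mu> ! c - k) \<and>
        (prec \<mu> r c \<longrightarrow>
           \<not> (\<tau> (c, \<mu> ! c - k) \<le> \<tau> (r, \<mu> ! r - l) \<and> \<tau> (r, \<mu> ! r - l) \<le> \<tau> (c, \<mu> ! c - Suc k)))) \<and>
     runs \<mu> \<tau> (q @ [(c, k)])"
  by pat_completeness auto
termination
  by (relation "measure (\<lambda>(\<mu>, \<tau>, q). \<Sum>(p, k)\<leftarrow>q. Suc k)") auto

definition boxes :: "nat list \<Rightarrow> (nat \<times> nat) list \<Rightarrow> box set" where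
  "boxes \<mu> q = {(c, j). \<exists>k. (c, k) \<in> set q \<and> \<mu> ! c - k < j \<and> j \<le> \<mu> ! c}"

text \<open>\<open>\<tau>0\<close> holds the basement and the boxes filled so far; fixing the
  labelling off the remaining boxes makes each sequence of choices a single element.\<close>

definition completions :: "nat list \<Rightarrow> (box \<Rightarrow> 'l::linorder) \<Rightarrow> (nat \<times> nat) list \<Rightarrow> (box \<Rightarrow> 'l) set" where
  "completions \<mu> \<tau>0 q = {\<tau>. (\<forall>u. u \<notin> boxes \<mu> q \<longrightarrow> \<tau> u = \<tau>0 u) \<and> runs \<mu> \<tau> q}"

lemma boxes_Nil [simp]: "boxes \<mu> [] = {}"
  by (simp add: boxes_def)

lemma boxes_Cons_0 [simp]: "boxes \<mu> ((c, 0) # q) = boxes \<mu> q"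
  by (auto simp: boxes_def)

lemma boxes_Cons_Suc:
  assumes "Suc k \<le> \<mu> ! c"
  shows "boxes \<mu> ((c, Suc k) # q) = insert (c, \<mu> ! c - k) (boxes \<mu> (q @ [(c, k)]))"
proof -
  have "\<mu> ! c - Suc k < j \<and> j \<le> \<mu> ! c \<longleftrightarrow> j = \<mu> ! c - k \<or> \<mu> ! c - k < j \<and> j \<le> \<mu> ! c" for j
    using assms by auto
  then show ?thesis
    unfolding boxes_def by (auto simp: set_eq_iff)
qed

lemma finite_boxes: "finite (boxes \<mu> q)"
  by (rule finite_subset[of _ "\<Union>(c, k)\<in>set q. {c} \<times> {..\<mu> ! c}"]) (auto simp: boxes_def)

text \<open>The completions split into disjoint classes by the label of the next box, which matches
  the sum over \<open>targets\<close>. \<open>nm\<close> translates the order \<open>prec\<close> of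
  columns into that of numbers.\<close>

lemma gen_poly_eq_sum_completions:
  fixes \<tau>0 :: "box \<Rightarrow> nat"
  assumes "distinct (map fst q)" "\<And>c k. (c, k) \<in> set q \<Longrightarrow> k \<le> \<mu> ! c"
    and "inj_on nm A" "names q \<subseteq> A"
    and "\<And>r c. r \<in> A \<Longrightarrow> c \<in> A \<Longrightarrow> nm r < nm c \<longleftrightarrow> prec \<mu> r c"
    and "\<And>c k. (c, k) \<in> set q \<Longrightarrow> b (nm c) = \<tau>0 (c, \<mu> ! c - k)"
  shows "finite (completions \<mu> \<tau>0 q) \<and>
    gen_poly xs (map (apfst nm) q) b = (\<Sum>\<tau>\<in>completions \<mu> \<tau>0 q. \<Prod>u\<in>boxes \<mu> q. var (xs ! \<tau> u))"
  using assms(1,2,4,6)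
proof (induction "\<Sum>(p, k)\<leftarrow>q. Suc k" arbitrary: q \<tau>0 b rule: less_induct)
  case less
  consider "q = []" | c q' where "q = (c, 0) # q'" | c k q' where "q = (c, Suc k) # q'"
    by (metis neq_Nil_conv not0_implies_Suc surj_pair)
  then show ?case
  proof cases
    case 1
    have "completions \<mu> \<tau>0 [] = {\<tau>0}"
      by (auto simp: completions_def)
    with 1 show ?thesis
      by simp
  next
    case (2 c q')
    have "completions \<mu> \<tau>0 ((c, 0) # q') = completions \<mu> \<tau>0 q'"
      by (simp add: completions_def)
    moreover have "finite (completions \<mu> \<tau>0 q') \<and>
        gen_poly xs (map (apfst nm) q') b = (\<Sum>\<tau>\<in>completions \<mu> \<tau>0 q'. \<Prod>u\<in>boxes \<mu> q'. var (xs ! \<tau> u))"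
      using less.prems 2 by (intro less.hyps) auto
    ultimately show ?thesis
      using 2 by simp
  next
    case (3 c k q')
    let ?x = "(c, \<mu> ! c - k)" and ?q = "q' @ [(c, k)]"
    let ?T = "targets (nm ` names q') (nm c) b"
    have dist: "distinct (map fst q')" "c \<notin> names q'" "Suc k \<le> \<mu> ! c" and A: "c \<in> A" "names q' \<subseteq> A"
      using less.prems 3 by (auto simp: names_def)
    have boxes: "boxes \<mu> q = insert ?x (boxes \<mu> ?q)"
      unfolding 3 using dist by (intro boxes_Cons_Suc)
    have x_notin: "?x \<notin> boxes \<mu> ?q"
      using dist by (force simp: boxes_def names_def)
    have nm_neq: "nm r \<noteq> nm c" if "r \<in> names q'" for r
      using assms(3) A that dist by (metis inj_onD subsetD)
    have rotated: "finite (completions \<mu> (\<tau>0(?x := e)) ?q) \<and>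
        gen_poly xs (map (apfst nm) ?q) (b(nm c := e)) =
        (\<Sum>\<tau>\<in>completions \<mu> (\<tau>0(?x := e)) ?q. \<Prod>u\<in>boxes \<mu> ?q. var (xs ! \<tau> u))" for e
    proof (rule less.hyps)
      show "(b(nm c := e)) (nm r) = (\<tau>0(?x := e)) (r, \<mu> ! r - l)" if "(r, l) \<in> set ?q" for r l
      proof (cases "(r, l) = (c, k)")
        case False
        then have rl: "(r, l) \<in> set q'" "r \<in> names q'"
          using that by (force simp: names_def)+
        then show ?thesis
          using nm_neq[of r] dist less.prems(4)[of r l] 3 by auto
      qed auto
      show "l \<le> \<mu> ! r" if "(r, l) \<in> set ?q" for r l
        using that less.prems(2)[of r l] 3 dist by auto
    qed (use less.prems 3 in auto)
    \<comment> \<open>The labels consulted by the move belong to boxes filled earlier, hence agree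
      for all completions.\<close>
    have below: "(c, \<mu> ! c - Suc k) \<notin> boxes \<mu> q"
      using dist unfolding 3 by (force simp: boxes_def names_def)
    have top: "(r, \<mu> ! r - l) \<notin> boxes \<mu> q" if "(r, l) \<in> set q'" for r l
    proof
      assume "(r, \<mu> ! r - l) \<in> boxes \<mu> q"
      then obtain l' where l': "(r, l') \<in> set q" "\<mu> ! r - l' < \<mu> ! r - l"
        unfolding boxes_def by blast
      have "r \<in> names q'"
        using that unfolding names_def by (metis fst_conv image_eqI)
      with dist l' 3 have "(r, l') \<in> set q'"
        by auto
      then have "l' = l"
        using dist(1) that by (metis eq_key_imp_eq_value)
      with l' show False
        by simp
    qed
    have label: "\<tau> ?x = e" if "\<tau> \<in> completions \<mu> (\<tau>0(?x := e)) ?q" for \<tau> e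
      using that x_notin by (simp add: completions_def)
    have completions: "completions \<mu> \<tau>0 q = (\<Union>e\<in>?T. completions \<mu> (\<tau>0(?x := e)) ?q)"
    proof -
      have "\<tau> \<in> completions \<mu> \<tau>0 q \<longleftrightarrow> \<tau> ?x \<in> ?T \<and> \<tau> \<in> completions \<mu> (\<tau>0(?x := \<tau> ?x)) ?q" for \<tau>
      proof (cases "\<forall>u. u \<notin> boxes \<mu> q \<longrightarrow> \<tau> u = \<tau>0 u")
        case True
        then have agree: "\<tau> (c, \<mu> ! c - Suc k) = b (nm c)"
          "\<And>r l. (r, l) \<in> set q' \<Longrightarrow> \<tau> (r, \<mu> ! r - l) = b (nm r)"
          using below top less.prems(4)[of c "Suc k"] less.prems(4) 3 by force+
        have "\<tau> ?x \<in> ?T \<longleftrightarrow> \<tau> ?x \<le> b (nm c) \<and>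
            (\<forall>(r, l) \<in> set q'. b (nm r) \<noteq> \<tau> ?x \<and>
              (nm r < nm c \<longrightarrow> \<not> (\<tau> ?x \<le> b (nm r) \<and> b (nm r) \<le> b (nm c))))"
          unfolding targets_def names_def by fastforce
        also have "\<dots> \<longleftrightarrow> \<tau> ?x \<le> \<tau> (c, \<mu> ! c - Suc k) \<and>
            (\<forall>(r, l) \<in> set q'. \<tau> (r, \<mu> ! r - l) \<noteq> \<tau> ?x \<and>
              (prec \<mu> r c \<longrightarrow> \<not> (\<tau> ?x \<le> \<tau> (r, \<mu> ! r - l) \<and> \<tau> (r, \<mu> ! r - l) \<le> \<tau> (c, \<mu> ! c - Suc k))))"
          using agree assms(5) A by (intro conj_cong ball_cong refl) (auto simp: names_def subset_iff)
        finally have "runs \<mu> \<tau> q \<longleftrightarrow> \<tau> ?x \<in> ?T \<and> runs \<mu> \<tau> ?q"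
          unfolding 3 by simp
        then show ?thesis
          using True boxes by (auto simp: completions_def)
      next
        case False
        then show ?thesis
          unfolding completions_def boxes by auto
      qed
      then show ?thesis
        using label by blast
    qed
    have "gen_poly xs (map (apfst nm) q) b =
        (\<Sum>e\<in>?T. var (xs ! e) * gen_poly xs (map (apfst nm) ?q) (b(nm c := e)))"
      by (simp add: 3 names_def image_image)
    also have "\<dots> = (\<Sum>e\<in>?T. \<Sum>\<tau>\<in>completions \<mu> (\<tau>0(?x := e)) ?q. \<Prod>u\<in>boxes \<mu> q. var (xs ! \<tau> u))"
      using label x_notin unfolding conjunct2[OF rotated] sum_distrib_left
      by (intro sum.cong refl) (auto simp: boxes finite_boxes dest: label)
    also have "\<dots> = (\<Sum>\<tau>\<in>completions \<mu> \<tau>0 q. \<Prod>u\<in>boxes \<mu> q. var (xs ! \<tau> u))"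
      unfolding completions using rotated by (subst sum.UNION_disjoint) (auto dest!: label)
    finally show ?thesis
      using rotated completions by auto
  qed
qed

text \<open>The queue when the box of column \<open>c\<close> in row \<open>Suc j\<close> is about to be filled.\<close>

definition queue_at :: "nat list \<Rightarrow> nat \<Rightarrow> nat \<Rightarrow> (nat \<times> nat) list" where
  "queue_at \<mu> c j =
     map (\<lambda>r. (r, \<mu> ! r - j)) (filter (\<lambda>r. j \<le> \<mu> ! r) [c..<length \<mu>]) @
     map (\<lambda>r. (r, \<mu> ! r - Suc j)) (filter (\<lambda>r. Suc j \<le> \<mu> ! r) [0..<c])"

text \<open>One step of \<open>runs\<close> in diagram coordinates. Columns to the left already show
  row \<open>Suc j\<close>, and those ending at row \<open>j\<close> have been dropped; columns to
  the right still show row \<open>j\<close>, including those ending there.\<close>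

definition box_ok :: "nat list \<Rightarrow> (box \<Rightarrow> 'l::linorder) \<Rightarrow> nat \<Rightarrow> nat \<Rightarrow> bool" where
  "box_ok \<mu> \<tau> c j \<longleftrightarrow>
     \<tau> (c, Suc j) \<le> \<tau> (c, j) \<and>
     (\<forall>r<c. Suc j \<le> \<mu> ! r \<longrightarrow> \<tau> (r, Suc j) \<noteq> \<tau> (c, Suc j) \<and>
        (prec \<mu> r c \<longrightarrow> \<not> (\<tau> (c, Suc j) \<le> \<tau> (r, Suc j) \<and> \<tau> (r, Suc j) \<le> \<tau> (c, j)))) \<and>
     (\<forall>r<length \<mu>. c < r \<longrightarrow> j \<le> \<mu> ! r \<longrightarrow> \<tau> (r, j) \<noteq> \<tau> (c, Suc j) \<and>
        (prec \<mu> r c \<longrightarrow> \<not> (\<tau> (c, Suc j) \<le> \<tau> (r, j) \<and> \<tau> (r, j) \<le> \<tau> (c, j))))"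

lemma runs_queue_at_Suc:
  assumes c: "c < length \<mu>"
  shows "runs \<mu> \<tau> (queue_at \<mu> c j) \<longleftrightarrow>
    (Suc j \<le> \<mu> ! c \<longrightarrow> box_ok \<mu> \<tau> c j) \<and> runs \<mu> \<tau> (queue_at \<mu> (Suc c) j)"
proof -
  have upt: "[c..<length \<mu>] = c # [Suc c..<length \<mu>]"
    using c by (simp add: upt_conv_Cons)
  \<comment> \<open>Column \<open>c\<close> was dropped before, is dropped now, or receives a
    box.\<close>
  consider "\<mu> ! c < j" | "\<mu> ! c = j" | k where "\<mu> ! c = Suc (j + k)"
    by (metis add_Suc_right less_imp_Suc_add linorder_neqE_nat)
  then show ?thesis
  proof cases
    case 3
    define A where "A = map (\<lambda>r. (r, \<mu> ! r - j)) (filter (\<lambda>r. j \<le> \<mu> ! r) [Suc c..<length \<mu>]) @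
        map (\<lambda>r. (r, \<mu> ! r - Suc j)) (filter (\<lambda>r. Suc j \<le> \<mu> ! r) [0..<c])"
    have now: "queue_at \<mu> c j = (c, Suc k) # A"
      using 3 by (simp add: queue_at_def upt A_def)
    have later: "queue_at \<mu> (Suc c) j = A @ [(c, k)]"
      using 3 by (simp add: queue_at_def A_def)
    have ball: "(\<forall>(r, l)\<in>set A. \<Phi> r (\<mu> ! r - l)) \<longleftrightarrow>
        (\<forall>r<c. Suc j \<le> \<mu> ! r \<longrightarrow> \<Phi> r (Suc j)) \<and> (\<forall>r<length \<mu>. c < r \<longrightarrow> j \<le> \<mu> ! r \<longrightarrow> \<Phi> r j)" for \<Phi>
      by (auto simp: A_def ball_Un)
    show ?thesis
      unfolding now later runs.simps box_ok_def
      using 3 ball[of "\<lambda>r i. \<tau> (r, i) \<noteq> \<tau> (c, Suc j) \<and>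
        (prec \<mu> r c \<longrightarrow> \<not> (\<tau> (c, Suc j) \<le> \<tau> (r, i) \<and> \<tau> (r, i) \<le> \<tau> (c, j)))"]
      by simp
  qed (simp_all add: queue_at_def upt)
qed

lemma runs_queue_at_row:
  "runs \<mu> \<tau> (queue_at \<mu> 0 j) \<longleftrightarrow>
    (\<forall>c<length \<mu>. Suc j \<le> \<mu> ! c \<longrightarrow> box_ok \<mu> \<tau> c j) \<and> runs \<mu> \<tau> (queue_at \<mu> 0 (Suc j))"
proof -
  have "runs \<mu> \<tau> (queue_at \<mu> 0 j) \<longleftrightarrow>
      (\<forall>r<c. Suc j \<le> \<mu> ! r \<longrightarrow> box_ok \<mu> \<tau> r j) \<and> runs \<mu> \<tau> (queue_at \<mu> c j)" if "c \<le> length \<mu>" for c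
    using that
  proof (induction c)
    case (Suc c)
    then show ?case
      using runs_queue_at_Suc[of c \<mu> \<tau> j] by (auto simp: less_Suc_eq)
  qed simp
  from this[of "length \<mu>"] show ?thesis
    by (simp add: queue_at_def)
qed

lemma runs_iff_box_ok:
  "runs \<mu> \<tau> (map (\<lambda>c. (c, \<mu> ! c)) [0..<length \<mu>]) \<longleftrightarrow>
    (\<forall>c j. c < length \<mu> \<longrightarrow> Suc j \<le> \<mu> ! c \<longrightarrow> box_ok \<mu> \<tau> c j)"
proof -
  have row: "runs \<mu> \<tau> (queue_at \<mu> 0 0) \<longleftrightarrow>
      (\<forall>j<J. \<forall>c<length \<mu>. Suc j \<le> \<mu> ! c \<longrightarrow> box_ok \<mu> \<tau> c j) \<and> runs \<mu> \<tau> (queue_at \<mu> 0 J)" for J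
  proof (induction J)
    case (Suc J)
    then show ?case
      using runs_queue_at_row[of \<mu> \<tau> J] unfolding less_Suc_eq by blast
  qed simp
  \<comment> \<open>A bound exceeding all heights: from this row on the queue is empty.\<close>
  define J where "J = Suc (\<Sum>c<length \<mu>. \<mu> ! c)"
  have J: "\<mu> ! c < J" if "c < length \<mu>" for c
    using that member_le_sum[of c "{..<length \<mu>}" "(!) \<mu>"] by (simp add: J_def)
  then have "filter (\<lambda>r. J \<le> \<mu> ! r) [0..<length \<mu>] = []"
    by (force simp: filter_empty_conv not_le)
  then have "queue_at \<mu> 0 J = []"
    by (simp add: queue_at_def)
  moreover have "queue_at \<mu> 0 0 = map (\<lambda>c. (c, \<mu> ! c)) [0..<length \<mu>]"
    by (simp add: queue_at_def)
  ultimately have "runs \<mu> \<tau> (map (\<lambda>c. (c, \<mu> ! c)) [0..<length \<mu>]) \<longleftrightarrow>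
      (\<forall>j<J. \<forall>c<length \<mu>. Suc j \<le> \<mu> ! c \<longrightarrow> box_ok \<mu> \<tau> c j)"
    using row[of J] by simp
  moreover have "j < J" if "c < length \<mu>" "Suc j \<le> \<mu> ! c" for c j
    using J[OF that(1)] that(2) by simp
  ultimately show ?thesis
    by blast
qed

text \<open>\<open>box_ok\<close> has weak inequalities where a triple has strict ones; the boundary
  cases are equalities between attacking boxes. The basement is not written by any move, so the
  distinctness of its labels is a hypothesis.\<close>

lemma box_ok_iff_filling_conditions:
  assumes basement: "inj_on (\<lambda>c. \<tau> (c, 0)) {..<length \<mu>}"
  shows "(\<forall>c j. c < length \<mu> \<longrightarrow> Suc j \<le> \<mu> ! c \<longrightarrow> box_ok \<mu> \<tau> c j) \<longleftrightarrow>
    non_attacking \<mu> \<tau> \<and> decreasing_upwards \<mu> \<tau> \<and> (\<nexists>u v w. coinversion_triple \<mu> \<tau> u v w)"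
    (is "?L \<longleftrightarrow> ?R")
proof
  assume L: ?L
  have dec: "\<tau> (c, Suc j) \<le> \<tau> (c, j)" if "c < length \<mu>" "Suc j \<le> \<mu> ! c" for c j
    using L that unfolding box_ok_def by blast
  have left: "\<tau> (r, Suc j) \<noteq> \<tau> (c, Suc j)" if "c < length \<mu>" "Suc j \<le> \<mu> ! c" "r < c" "Suc j \<le> \<mu> ! r" for c j r
    using L that unfolding box_ok_def by blast
  have right: "\<tau> (r, j) \<noteq> \<tau> (c, Suc j)" if "c < length \<mu>" "Suc j \<le> \<mu> ! c" "r < length \<mu>" "c < r" "j \<le> \<mu> ! r" for c j r
    using L that unfolding box_ok_def by blast
  have row: "\<tau> (r, j) \<noteq> \<tau> (c, j)" if "c < length \<mu>" "r < length \<mu>" "r \<noteq> c" "j \<le> \<mu> ! c" "j \<le> \<mu> ! r" for c j r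
  proof (cases j)
    case 0
    then show ?thesis
      using basement that by (auto simp: inj_on_def)
  next
    case (Suc j')
    then show ?thesis
      using left[of c j' r] left[of r j' c] that by (cases r c rule: linorder_cases) auto
  qed
  have aug: "u \<in> aug_dg \<mu> \<longleftrightarrow> fst u < length \<mu> \<and> snd u \<le> \<mu> ! fst u" for u
    by (cases u) (auto simp: aug_dg_def dg_def)
  have "non_attacking \<mu> \<tau>"
    unfolding non_attacking_def
  proof (intro ballI impI)
    fix u v assume "u \<in> aug_dg \<mu>" "v \<in> aug_dg \<mu>" "attacking u v"
    then show "\<tau> u \<noteq> \<tau> v"
      using row[of "fst u" "fst v" "snd u"] right[of "fst u" "snd v" "fst v"] right[of "fst v" "snd u" "fst u"]
      unfolding attacking_def aug by (cases u; cases v) auto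
  qed
  moreover have "decreasing_upwards \<mu> \<tau>"
    unfolding decreasing_upwards_def
  proof
    fix u assume "u \<in> dg \<mu>"
    then show "\<tau> u \<le> \<tau> (box_below u)"
      using dec[of "fst u" "snd u - 1"] by (cases u) (auto simp: dg_def)
  qed
  moreover have "\<not> coinversion_triple \<mu> \<tau> u v w" for u v w
  proof
    assume triple: "coinversion_triple \<mu> \<tau> u v w"
    then obtain c j where u: "u = (c, Suc j)" "c < length \<mu>" "Suc j \<le> \<mu> ! c"
      unfolding coinversion_triple_def dg_def by (cases u) (auto dest: Suc_le_D)
    have w: "w = (c, j)"
      using triple u by (simp add: coinversion_triple_def)
    have uvw: "\<tau> u < \<tau> v" "\<tau> v < \<tau> w"
      using triple dec[OF u(2,3)] unfolding coinversion_triple_def u(1) w by auto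
    have "v \<in> arm \<mu> u"
      using triple by (simp add: coinversion_triple_def)
    then consider r where "v = (r, Suc j)" "r < c" "Suc j \<le> \<mu> ! r" "\<mu> ! r \<le> \<mu> ! c" "r < length \<mu>"
      | r where "v = (r, j)" "c < r" "j \<le> \<mu> ! r" "\<mu> ! r < \<mu> ! c" "r < length \<mu>"
      unfolding u(1) by (auto simp: dg_def aug_dg_def)
    then show False
    proof cases
      case 1
      then have "\<not> (\<tau> u \<le> \<tau> v \<and> \<tau> v \<le> \<tau> w)"
        using L u w unfolding box_ok_def prec_def by (metis le_neq_implies_less)
      with uvw show False
        by (simp add: less_imp_le)
    next
      case 2
      then have "\<not> (\<tau> u \<le> \<tau> v \<and> \<tau> v \<le> \<tau> w)"
        using L u w unfolding box_ok_def prec_def by metis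
      with uvw show False
        by (simp add: less_imp_le)
    qed
  qed
  ultimately show ?R
    by blast
next
  assume R: ?R
  have attack: "\<tau> u \<noteq> \<tau> v" if "u \<in> aug_dg \<mu>" "v \<in> aug_dg \<mu>" "attacking u v" for u v
    using R that unfolding non_attacking_def by blast
  have aug: "(c, j) \<in> aug_dg \<mu> \<longleftrightarrow> c < length \<mu> \<and> j \<le> \<mu> ! c" for c j
    by (auto simp: aug_dg_def dg_def)
  show ?L
  proof (intro allI impI)
    fix c j assume c: "c < length \<mu>" "Suc j \<le> \<mu> ! c"
    have u: "(c, Suc j) \<in> dg \<mu>"
      using c by (simp add: dg_def)
    have dec: "\<tau> (c, Suc j) \<le> \<tau> (c, j)"
      using R u unfolding decreasing_upwards_def by fastforce
    have no_triple: "\<not> (\<tau> (c, Suc j) < \<tau> v \<and> \<tau> v < \<tau> (c, j))" if "v \<in> arm \<mu> (c, Suc j)" for v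
      using R u that unfolding coinversion_triple_def by (metis box_below.simps diff_Suc_1)
    show "box_ok \<mu> \<tau> c j"
      unfolding box_ok_def
    proof (intro conjI allI impI dec)
      fix r assume r: "r < c" "Suc j \<le> \<mu> ! r"
      show ne: "\<tau> (r, Suc j) \<noteq> \<tau> (c, Suc j)"
        using r c by (intro attack) (auto simp: aug attacking_def)
      assume "prec \<mu> r c"
      then have "(r, Suc j) \<in> arm \<mu> (c, Suc j)"
        using r c by (auto simp: prec_def dg_def)
      moreover have "\<tau> (r, Suc j) \<noteq> \<tau> (c, j)"
        using r c by (intro attack) (auto simp: aug attacking_def)
      ultimately show "\<not> (\<tau> (c, Suc j) \<le> \<tau> (r, Suc j) \<and> \<tau> (r, Suc j) \<le> \<tau> (c, j))"
        using no_triple[of "(r, Suc j)"] ne by auto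
    next
      fix r assume r: "r < length \<mu>" "c < r" "j \<le> \<mu> ! r"
      show ne: "\<tau> (r, j) \<noteq> \<tau> (c, Suc j)"
        using r c by (intro attack) (auto simp: aug attacking_def)
      assume "prec \<mu> r c"
      then have "(r, j) \<in> arm \<mu> (c, Suc j)"
        using r c by (auto simp: prec_def aug)
      moreover have "\<tau> (r, j) \<noteq> \<tau> (c, j)"
        using r c by (intro attack) (auto simp: aug attacking_def)
      ultimately show "\<not> (\<tau> (c, Suc j) \<le> \<tau> (r, j) \<and> \<tau> (r, j) \<le> \<tau> (c, j))"
        using no_triple[of "(r, j)"] ne by auto
    qed
  qed
qed

text \<open>Labels enter only through comparisons, so the condition can pass from indices of
  variables to letters and symbols \<omega>.\<close>

lemma box_ok_cong:
  assumes "\<And>u v. u \<in> aug_dg \<mu> \<Longrightarrow> v \<in> aug_dg \<mu> \<Longrightarrow> \<tau> u \<le> \<tau> v \<longleftrightarrow> \<tau>' u \<le> \<tau>' v"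
    and c: "c < length \<mu>" "Suc j \<le> \<mu> ! c"
  shows "box_ok \<mu> \<tau> c j \<longleftrightarrow> box_ok \<mu> \<tau>' c j"
proof -
  have aug: "(r, i) \<in> aug_dg \<mu> \<longleftrightarrow> r < length \<mu> \<and> i \<le> \<mu> ! r" for r i
    by (auto simp: aug_dg_def dg_def)
  have le: "\<tau> (r, i) \<le> \<tau> (s, k) \<longleftrightarrow> \<tau>' (r, i) \<le> \<tau>' (s, k)"
    "\<tau> (r, i) = \<tau> (s, k) \<longleftrightarrow> \<tau>' (r, i) = \<tau>' (s, k)"
    if "r < length \<mu>" "i \<le> \<mu> ! r" "s < length \<mu>" "k \<le> \<mu> ! s" for r i s k
    using assms(1)[of "(r, i)" "(s, k)"] assms(1)[of "(s, k)" "(r, i)"] that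
    by (auto simp: aug order_antisym_conv intro: order_antisym)
  show ?thesis
    unfolding box_ok_def using c by (auto simp: le)
qed

section \<open>Stable limit\<close>

lemma in_block_vars: "(j, i) \<in> set (block_vars ls n) \<longleftrightarrow> j < length ls \<and> i < n j"
  by (force simp: block_vars_def)

lemma sorted_block_vars: "sorted_wrt (<) (block_vars ls n)"
proof -
  have "sorted_wrt (<) (concat (map (\<lambda>j. map (\<lambda>i. (j, i)) [0..<n j]) [0..<r]))" for r
  proof (induction r)
    case (Suc r)
    have "sorted_wrt (<) (map (\<lambda>i. (r, i)) [0..<n r])"
      by (simp add: sorted_wrt_map)
    with Suc show ?case
      by (auto simp: sorted_wrt_append)
  qed simp
  then show ?thesis
    by (simp add: block_vars_def)
qed

lemma zip_concat:
  "(\<And>j. j \<in> set js \<Longrightarrow> length (f j) = length (g j)) \<Longrightarrow>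
    zip (concat (map f js)) (concat (map g js)) = concat (map (\<lambda>j. zip (f j) (g j)) js)"
  by (induction js) simp_all

lemma length_block_vars:
  "\<forall>j<length ls. length (ls ! j) \<le> n j \<Longrightarrow> length (block_vars ls n) = length (padded_comp ls n)"
  unfolding block_vars_def padded_comp_def length_concat by (auto intro!: arg_cong[of _ _ sum_list])

definition top_vars :: "nat list list \<Rightarrow> (nat \<Rightarrow> nat) \<Rightarrow> (nat \<times> nat) list" where
  "top_vars ls n = concat (map (\<lambda>j. map (\<lambda>i. (j, i)) [n j - length (ls ! j)..<n j]) [0..<length ls])"

lemma filter_nonzero_columns:
  assumes part: "\<forall>l \<in> set ls. is_partition l" and n: "\<forall>j<length ls. length (ls ! j) \<le> n j"
  shows "filter (\<lambda>x. snd x \<noteq> 0) (zip (block_vars ls n) (padded_comp ls n)) = zip (top_vars ls n) (shape ls)"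
proof -
  have block: "filter (\<lambda>x. snd x \<noteq> 0)
      (zip (map (\<lambda>i. (j, i)) [0..<n j]) (replicate (n j - length (ls ! j)) 0 @ rev (ls ! j))) =
      zip (map (\<lambda>i. (j, i)) [n j - length (ls ! j)..<n j]) (rev (ls ! j))" if j: "j < length ls" for j
  proof -
    have upt: "[0..<n j] = [0..<n j - length (ls ! j)] @ [n j - length (ls ! j)..<n j]"
      using upt_add_eq_append[of 0 "n j - length (ls ! j)" "length (ls ! j)"] n j by simp
    have "filter (\<lambda>x. snd x \<noteq> 0) (zip (map (\<lambda>i. (j, i)) [0..<n j - length (ls ! j)])
        (replicate (n j - length (ls ! j)) (0::nat))) = []"
      by (auto simp: filter_empty_conv dest: set_zip_rightD)
    moreover have "0 \<notin> set (ls ! j)"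
      using part j by (auto simp: is_partition_def)
    then have "filter (\<lambda>x. snd x \<noteq> 0) (zip (map (\<lambda>i. (j, i)) [n j - length (ls ! j)..<n j]) (rev (ls ! j))) =
        zip (map (\<lambda>i. (j, i)) [n j - length (ls ! j)..<n j]) (rev (ls ! j))"
      by (intro filter_True ballI) (metis prod.collapse set_rev set_zip_rightD)
    ultimately show ?thesis
      unfolding upt map_append by (subst zip_append) simp_all
  qed
  have shape_eq: "shape ls = concat (map (\<lambda>j. rev (ls ! j)) [0..<length ls])"
    unfolding shape_def by (metis (no_types, lifting) map_nth list.map_comp comp_def map_eq_conv)
  have shape: "zip (top_vars ls n) (shape ls) = concat (map (\<lambda>j. zip (map (\<lambda>i. (j, i))
      [n j - length (ls ! j)..<n j]) (rev (ls ! j))) [0..<length ls])"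
    unfolding top_vars_def shape_eq using n by (intro zip_concat) simp
  have "zip (block_vars ls n) (padded_comp ls n) = concat (map (\<lambda>j. zip (map (\<lambda>i. (j, i)) [0..<n j])
      (replicate (n j - length (ls ! j)) 0 @ rev (ls ! j))) [0..<length ls])"
    unfolding block_vars_def padded_comp_def using n by (intro zip_concat) simp
  moreover have "map (\<lambda>j. filter (\<lambda>x. snd x \<noteq> 0) (zip (map (\<lambda>i. (j, i)) [0..<n j])
      (replicate (n j - length (ls ! j)) 0 @ rev (ls ! j)))) [0..<length ls] =
      map (\<lambda>j. zip (map (\<lambda>i. (j, i)) [n j - length (ls ! j)..<n j]) (rev (ls ! j))) [0..<length ls]"
    using block by (intro map_cong refl) simp
  ultimately show ?thesis
    unfolding shape filter_concat by (simp only: filter_concat list.map_comp comp_def)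
qed

lemma length_top_vars:
  "\<forall>j<length ls. length (ls ! j) \<le> n j \<Longrightarrow> length (top_vars ls n) = length (shape ls)"
  unfolding top_vars_def shape_def length_concat
  by (auto intro!: arg_cong[of _ _ sum_list] nth_equalityI simp: comp_def)

text \<open>In block \<open>j\<close> the last \<open>length (ls ! j)\<close> variables are the basement labels of the nonempty columns.\<close>

definition var_label :: "nat list list \<Rightarrow> (nat \<Rightarrow> nat) \<Rightarrow> nat \<times> nat \<Rightarrow> label" where
  "var_label ls n x = (case x of (j, i) \<Rightarrow>
     if i < n j - length (ls ! j) then Letter j i else Omega j (i - (n j - length (ls ! j))))"

lemma var_label_less: "x < y \<Longrightarrow> var_label ls n x < var_label ls n y"
  by (cases x; cases y; cases "fst x = fst y") (auto simp: var_label_def)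

lemma var_label_le_iff: "var_label ls n x \<le> var_label ls n y \<longleftrightarrow> x \<le> y"
  using var_label_less[of x y ls n] var_label_less[of y x ls n] by (metis linorder_not_le order_le_less)

lemma basement_eq_var_label:
  assumes "\<forall>j<length ls. length (ls ! j) \<le> n j"
  shows "basement ls = map (var_label ls n) (top_vars ls n)"
proof -
  have "map (Omega j) [0..<length (ls ! j)] = map (var_label ls n) (map (\<lambda>i. (j, i)) [n j - length (ls ! j)..<n j])"
    if "j < length ls" for j
    using assms that by (intro nth_equalityI) (auto simp: var_label_def)
  then show ?thesis
    unfolding basement_def top_vars_def map_concat by (auto intro!: arg_cong[of _ _ concat])
qed

section \<open>Coefficients as numbers of fillings\<close>

definition content :: "box set \<Rightarrow> (box \<Rightarrow> 'v) \<Rightarrow> 'v mono" where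
  "content B g = (\<Sum>u\<in>B. Poly_Mapping.single (g u) 1)"

lemma prod_var_eq_single:
  "finite B \<Longrightarrow> (\<Prod>u\<in>B. var (g u)) = Poly_Mapping.single (content B g) 1"
  by (induction B rule: finite_induct) (simp_all add: content_def var_def mult_single)

lemma lookup_prod_var:
  "finite B \<Longrightarrow> Poly_Mapping.lookup (\<Prod>u\<in>B. var (g u)) m = (if content B g = m then 1 else 0)"
  by (simp add: prod_var_eq_single lookup_single when_def)

lemma in_keys_content:
  assumes "finite B" "u \<in> B"
  shows "g u \<in> Poly_Mapping.keys (content B g)"
proof -
  have "0 < Poly_Mapping.lookup (content B g) (g u)"
    unfolding content_def lookup_sum using assms by (intro sum_pos2[of _ u]) auto
  then show ?thesis
    by (simp add: in_keys_iff)
qed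

lemma content_cong: "(\<And>u. u \<in> B \<Longrightarrow> g u = h u) \<Longrightarrow> content B g = content B h"
  by (simp add: content_def)

lemma finite_dg: "finite (dg \<mu>)"
  by (rule finite_subset[of _ "\<Union>i<length \<mu>. {i} \<times> {..\<mu> ! i}"]) (auto simp: dg_def)

lemma filling_weight_eq: "filling_weight ls \<sigma> = (\<Prod>u\<in>dg (shape ls). var (\<sigma> u))"
proof -
  have "(\<Prod>u\<in>dg (shape ls). var (\<sigma> u)) =
      (\<Prod>x\<in>\<sigma> ` dg (shape ls). \<Prod>u\<in>{u \<in> dg (shape ls). \<sigma> u = x}. var (\<sigma> u))"
    by (rule prod.image_gen[OF finite_dg])
  also have "\<dots> = filling_weight ls \<sigma>"
    unfolding filling_weight_def by (intro prod.cong refl) simp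
  finally show ?thesis ..
qed

text \<open>In a filling contributing to \<open>m\<close> every box is labelled by a variable of
  \<open>m\<close>. \<open>large\<close> keeps these variables before the basement variables of
  their blocks, so the order among all labels in play is the same as with the symbols
  \<omega>.\<close>

lemma lookup_key_poly_eq_card:
  assumes part: "\<forall>l \<in> set ls. is_partition l" and n: "\<forall>j<length ls. length (ls ! j) \<le> n j"
    and large: "\<And>j i. j < length ls \<Longrightarrow> (j, i) \<in> Poly_Mapping.keys m \<Longrightarrow> i < n j - length (ls ! j)"
  shows "Poly_Mapping.lookup (key_poly (block_vars ls n) (padded_comp ls n)) m =
    int (card {\<sigma> \<in> fillings ls. content (dg (shape ls)) \<sigma> = m})"
proof -
  define xs where "xs = block_vars ls n"
  define \<alpha> where "\<alpha> = padded_comp ls n"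
  define \<mu> where "\<mu> = shape ls"
  define N where "N = length xs"
  define I where "I = filter (\<lambda>P. \<alpha> ! P \<noteq> 0) [0..<N]"
  define L where "L = length \<mu>"
  have len: "length \<alpha> = N"
    using length_block_vars[OF n] by (simp add: \<alpha>_def N_def xs_def)
  have "zip xs \<alpha> = map (\<lambda>P. (xs ! P, \<alpha> ! P)) [0..<N]"
    using len by (intro nth_equalityI) (auto simp: N_def)
  then have zip: "map (\<lambda>P. (xs ! P, \<alpha> ! P)) I = zip (top_vars ls n) \<mu>"
    using filter_nonzero_columns[OF part n] by (simp add: xs_def \<alpha>_def \<mu>_def I_def filter_map comp_def)
  have len_top: "length (top_vars ls n) = L"
    using length_top_vars[OF n] by (simp add: L_def \<mu>_def)
  have len_I: "length I = L"
    using arg_cong[OF zip, of length] len_top by (simp add: L_def)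
  have I: "xs ! (I ! c) = top_vars ls n ! c" "\<alpha> ! (I ! c) = \<mu> ! c" if "c < L" for c
    using arg_cong[OF zip, of "\<lambda>zs. zs ! c"] that len_I len_top by (auto simp: L_def)
  have sorted_I: "sorted_wrt (<) I"
    by (simp add: I_def sorted_wrt_filter)
  have I_less: "I ! r < I ! c" if "r < c" "c < L" for r c
    using sorted_I that len_I by (simp add: sorted_wrt_iff_nth_less)
  have I_N: "I ! c < N" if "c < L" for c
    using nth_mem[of c I] that len_I by (auto simp: I_def)
  have sorted_xs: "sorted_wrt (<) xs"
    by (simp add: xs_def sorted_block_vars)
  have xs_le: "xs ! e \<le> xs ! e' \<longleftrightarrow> e \<le> e'" if "e < N" "e' < N" for e e'
    using sorted_xs that unfolding sorted_wrt_iff_nth_less N_def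
    by (metis linorder_not_le order_le_less)
  have distinct_xs: "distinct xs"
    using sorted_xs strict_sorted_iff by blast
  \<comment> \<open>Writing (height, position) in base \<open>N\<close> makes the numeric order
    lexicographic, and \<open>mod N\<close> recovers the position, which is the initial
    label.\<close>
  define nm where "nm c = \<mu> ! c * N + I ! c" for c
  define b where "b p = p mod N" for p
  define full where "full = map (\<lambda>P. (\<alpha> ! P * N + P, \<alpha> ! P)) [0..<N]"
  define Q where "Q = map (\<lambda>c. (c, \<mu> ! c)) [0..<L]"
  \<comment> \<open>Each nonempty column starts with its position among all columns, padding
    included.\<close>
  define \<tau>0 where "\<tau>0 = (\<lambda>(c, j :: nat). I ! c)"
  have name_less: "x * N + P < y * N + R \<longleftrightarrow> x < y \<or> x = y \<and> P < R" if "P < N" "R < N" for x y P R :: nat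
  proof -
    have *: "x * N + P < y * N + R" if "x < y" "P < N" for x y P R :: nat
    proof -
      have "x * N + P < Suc x * N"
        using that by simp
      also have "\<dots> \<le> y * N"
        using that by (intro mult_right_mono) auto
      finally show ?thesis
        by simp
    qed
    show ?thesis
      using *[of x y P R] *[of y x R P] that by (cases x y rule: linorder_cases) auto
  qed
  have valid: "valid_queue full"
    unfolding valid_queue_def
  proof
    have "inj_on (\<lambda>P. \<alpha> ! P * N + P) {0..<N}"
      by (rule inj_on_inverseI[of _ "\<lambda>p. p mod N"]) simp
    then show "distinct (map fst full)"
      by (simp add: full_def distinct_map comp_def)
    show "sorted_wrt (\<lambda>(p, k) (r, l). p < r \<longleftrightarrow> k \<le> l) full"
      unfolding full_def sorted_wrt_iff_nth_less by (auto simp: name_less)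
  qed
  have "key_poly xs \<alpha> = gen_poly xs full b"
  proof -
    have "map snd full = \<alpha>"
      using len by (intro nth_equalityI) (auto simp: full_def)
    moreover have "key_poly xs (map snd full) = gen_poly xs full b"
      using valid by (intro key_poly_eq_gen_poly[OF distinct_xs]) (auto simp: full_def b_def N_def)
    ultimately show ?thesis
      by simp
  qed
  also have "\<dots> = gen_poly xs (filter (\<lambda>x. snd x \<noteq> 0) full) b"
  proof -
    have "sorted_wrt (\<lambda>x y. b (fst x) < b (fst y)) full"
      unfolding full_def sorted_wrt_iff_nth_less b_def by auto
    from gen_poly_drop_zeros[OF this, of xs "[]"] valid show ?thesis
      by (simp add: valid_queue_def)
  qed
  also have "filter (\<lambda>x. snd x \<noteq> 0) full = map (apfst nm) Q"
  proof -
    have "filter (\<lambda>x. snd x \<noteq> 0) full = map (\<lambda>P. (\<alpha> ! P * N + P, \<alpha> ! P)) I"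
      by (simp add: full_def I_def filter_map comp_def)
    also have "\<dots> = map (apfst nm) Q"
      using len_I I by (intro nth_equalityI) (auto simp: Q_def nm_def)
    finally show ?thesis .
  qed
  finally have key: "key_poly xs \<alpha> = gen_poly xs (map (apfst nm) Q) b" .
  have nm_less: "nm r < nm c \<longleftrightarrow> prec \<mu> r c" if "r < L" "c < L" for r c
    using I_less[of r c] I_less[of c r] that unfolding nm_def prec_def name_less[OF I_N[OF that(1)] I_N[OF that(2)]]
    by (cases r c rule: linorder_cases) auto
  have boxes: "boxes \<mu> Q = dg \<mu>"
  proof -
    have "(c, k) \<in> set Q \<longleftrightarrow> c < L \<and> k = \<mu> ! c" for c k
      by (auto simp: Q_def)
    then show ?thesis
      by (auto simp: boxes_def dg_def L_def)
  qed
  have "finite (completions \<mu> \<tau>0 Q) \<and>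
    gen_poly xs (map (apfst nm) Q) b = (\<Sum>\<tau>\<in>completions \<mu> \<tau>0 Q. \<Prod>u\<in>boxes \<mu> Q. var (xs ! \<tau> u))"
  proof (rule gen_poly_eq_sum_completions[where A = "{..<L}"])
    show "inj_on nm {..<L}"
    proof (rule inj_on_inverseI)
      fix c assume "c \<in> {..<L}"
      then have c: "c < L"
        by simp
      show "inv_into {..<L} ((!) I) (nm c mod N) = c"
        using c I_N[OF c] len_I sorted_I
        by (auto simp: nm_def intro!: inv_into_f_eq inj_on_nth simp: strict_sorted_iff)
    qed
    show "b (nm c) = \<tau>0 (c, \<mu> ! c - k)" if "(c, k) \<in> set Q" for c k
      using that I_N[of c] by (auto simp: Q_def b_def nm_def \<tau>0_def)
  qed (auto simp: Q_def nm_less comp_def names_def)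
  then have fin: "finite (completions \<mu> \<tau>0 Q)"
    and sum: "key_poly xs \<alpha> = (\<Sum>\<tau>\<in>completions \<mu> \<tau>0 Q. \<Prod>u\<in>dg \<mu>. var (xs ! \<tau> u))"
    by (simp_all add: key boxes)
  define S where "S = {\<tau> \<in> completions \<mu> \<tau>0 Q. content (dg \<mu>) (\<lambda>u. xs ! \<tau> u) = m}"
  have "Poly_Mapping.lookup (key_poly xs \<alpha>) m = (\<Sum>\<tau>\<in>completions \<mu> \<tau>0 Q. if content (dg \<mu>) (\<lambda>u. xs ! \<tau> u) = m then 1 else 0)"
    unfolding sum lookup_sum lookup_prod_var[OF finite_dg] ..
  also have "\<dots> = int (card S)"
    using fin by (simp add: S_def sum.If_cases Int_def)
  finally have lookup: "Poly_Mapping.lookup (key_poly xs \<alpha>) m = int (card S)" .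

  have aug: "u \<in> aug_dg \<mu> \<longleftrightarrow> u \<in> dg \<mu> \<or> fst u < L \<and> snd u = 0" for u
    by (cases u) (auto simp: aug_dg_def L_def)
  have dg_snd: "snd u \<noteq> 0" "fst u < L" if "u \<in> dg \<mu>" for u
    using that by (auto simp: dg_def L_def)
  have runs_iff: "runs \<mu> \<tau> Q \<longleftrightarrow> non_attacking \<mu> (augment ls \<sigma>) \<and> decreasing_upwards \<mu> (augment ls \<sigma>) \<and>
      (\<nexists>u v w. coinversion_triple \<mu> (augment ls \<sigma>) u v w)"
    if out: "\<And>u. u \<notin> dg \<mu> \<Longrightarrow> \<tau> u = \<tau>0 u"
      and \<tau>: "\<And>u. u \<in> dg \<mu> \<Longrightarrow> \<tau> u < N \<and> xs ! \<tau> u = \<sigma> u \<and> \<sigma> u \<in> Poly_Mapping.keys m" for \<tau> \<sigma>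
  proof -
    have base: "augment ls \<sigma> (c, 0) = var_label ls n (xs ! (I ! c))" if "c < L" for c
      using that I(1)[OF that] len_top by (simp add: augment_def basement_eq_var_label[OF n])
    have label: "augment ls \<sigma> u = var_label ls n (xs ! \<tau> u) \<and> \<tau> u < N" if "u \<in> aug_dg \<mu>" for u
    proof (cases "u \<in> dg \<mu>")
      case True
      obtain j i where ji: "\<sigma> u = (j, i)"
        by (cases "\<sigma> u")
      then have "j < length ls"
        using \<tau>[OF True] nth_mem[of "\<tau> u" xs] in_block_vars[of j i ls n] by (simp add: N_def xs_def)
      \<comment> \<open>By \<open>large\<close> the index lies where \<open>var_label\<close> is a
        letter, in agreement with \<open>augment\<close>.\<close>
      with ji True \<tau>[OF True] large[of j i] dg_snd[OF True] show ?thesis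
        by (simp add: augment_def var_label_def)
    next
      case False
      with that obtain c where c: "u = (c, 0)" "c < L"
        unfolding aug by (cases u) auto
      with out[OF False] base[OF c(2)] I_N[OF c(2)] show ?thesis
        by (simp add: \<tau>0_def)
    qed
    have "inj_on (\<lambda>c. augment ls \<sigma> (c, 0)) {..<length \<mu>}"
    proof (rule linorder_inj_onI)
      fix r c assume rc: "r < c" "r \<in> {..<length \<mu>}" "c \<in> {..<length \<mu>}"
      then have "xs ! (I ! r) < xs ! (I ! c)"
        using xs_le[of "I ! c" "I ! r"] I_less[of r c] I_N[of c] I_N[of r] by (auto simp: L_def not_le[symmetric])
      then show "augment ls \<sigma> (r, 0) \<noteq> augment ls \<sigma> (c, 0)"
        using base[of r] base[of c] rc var_label_less by (metis L_def lessThan_iff less_irrefl)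
    qed auto
    from box_ok_iff_filling_conditions[OF this]
    have "(non_attacking \<mu> (augment ls \<sigma>) \<and> decreasing_upwards \<mu> (augment ls \<sigma>) \<and>
        (\<nexists>u v w. coinversion_triple \<mu> (augment ls \<sigma>) u v w)) \<longleftrightarrow>
        (\<forall>c j. c < length \<mu> \<longrightarrow> Suc j \<le> \<mu> ! c \<longrightarrow> box_ok \<mu> (augment ls \<sigma>) c j)"
      by simp
    also have "\<dots> \<longleftrightarrow> (\<forall>c j. c < length \<mu> \<longrightarrow> Suc j \<le> \<mu> ! c \<longrightarrow> box_ok \<mu> \<tau> c j)"
      using label by (intro all_cong1 imp_cong refl box_ok_cong) (simp_all add: var_label_le_iff xs_le)
    also have "\<dots> \<longleftrightarrow> runs \<mu> \<tau> Q"
      unfolding Q_def L_def runs_iff_box_ok ..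
    finally show ?thesis ..
  qed
  define pos where "pos = inv_into {..<N} ((!) xs)"
  have pos: "pos (xs ! e) = e" if "e < N" for e
    using that distinct_xs unfolding pos_def by (intro inv_into_f_f inj_on_nth) (auto simp: N_def)
  have pos': "xs ! pos x = x \<and> pos x < N" if "x \<in> set xs" for x
    using that pos unfolding in_set_conv_nth N_def by metis
  have bij: "bij_betw (\<lambda>\<tau>. restrict (\<lambda>u. xs ! \<tau> u) (dg \<mu>)) S {\<sigma> \<in> fillings ls. content (dg \<mu>) \<sigma> = m}"
  proof (rule bij_betw_byWitness[where f' = "\<lambda>\<sigma> u. if u \<in> dg \<mu> then pos (\<sigma> u) else \<tau>0 u"])
    have S: "\<tau> u = \<tau>0 u" if "\<tau> \<in> S" "u \<notin> dg \<mu>" for \<tau> u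
      using that unfolding S_def completions_def boxes by blast
    \<comment> \<open>Labels decrease upwards from basement labels that are below
      \<open>N\<close>.\<close>
    have S_N: "\<tau> u < N" if "\<tau> \<in> S" "u \<in> dg \<mu>" for \<tau> u
    proof -
      have ok: "\<forall>c j. c < length \<mu> \<longrightarrow> Suc j \<le> \<mu> ! c \<longrightarrow> box_ok \<mu> \<tau> c j"
        using that(1) runs_iff_box_ok[of \<mu> \<tau>] by (simp add: S_def completions_def Q_def L_def)
      have "\<tau> (c, j) < N" if "c < L" "j \<le> \<mu> ! c" for c j
        using that(2)
      proof (induction j)
        case 0
        have "(c, 0) \<notin> dg \<mu>"
          by (simp add: dg_def)
        then show ?case
          using S[OF \<open>\<tau> \<in> S\<close>] I_N[OF that(1)] by (simp add: \<tau>0_def)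
      next
        case (Suc j)
        then have "\<tau> (c, Suc j) \<le> \<tau> (c, j)"
          using ok that(1) by (simp add: L_def box_ok_def)
        with Suc show ?case
          by simp
      qed
      then show ?thesis
        using that(2) by (cases u) (auto simp: dg_def L_def)
    qed
    have S_keys: "xs ! \<tau> u \<in> Poly_Mapping.keys m" if "\<tau> \<in> S" "u \<in> dg \<mu>" for \<tau> u
      using that in_keys_content[OF finite_dg that(2), of "\<lambda>u. xs ! \<tau> u"] by (simp add: S_def)
    show "\<forall>\<tau>\<in>S. (\<lambda>u. if u \<in> dg \<mu> then pos (restrict (\<lambda>u. xs ! \<tau> u) (dg \<mu>) u) else \<tau>0 u) = \<tau>"
      using S S_N pos by (auto simp: fun_eq_iff)
    show "(\<lambda>\<tau>. restrict (\<lambda>u. xs ! \<tau> u) (dg \<mu>)) ` S \<subseteq> {\<sigma> \<in> fillings ls. content (dg \<mu>) \<sigma> = m}"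
    proof clarify
      fix \<tau> assume \<tau>: "\<tau> \<in> S"
      let ?\<sigma> = "restrict (\<lambda>u. xs ! \<tau> u) (dg \<mu>)"
      have "fst (xs ! \<tau> u) < length ls" if "u \<in> dg \<mu>" for u
        using nth_mem[of "\<tau> u" xs] S_N[OF \<tau> that] in_block_vars[of "fst (xs ! \<tau> u)" "snd (xs ! \<tau> u)" ls n]
        by (simp add: N_def xs_def)
      then have "?\<sigma> \<in> dg \<mu> \<rightarrow>\<^sub>E {(j, i). j < length ls}"
        by (auto simp: split_beta)
      moreover have "runs \<mu> \<tau> Q"
        using \<tau> by (simp add: S_def completions_def)
      then have "non_attacking \<mu> (augment ls ?\<sigma>) \<and> decreasing_upwards \<mu> (augment ls ?\<sigma>) \<and>
          (\<nexists>u v w. coinversion_triple \<mu> (augment ls ?\<sigma>) u v w)"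
        using S[OF \<tau>] S_N[OF \<tau>] S_keys[OF \<tau>] by (subst runs_iff[symmetric, of \<tau>]) auto
      moreover have "content (dg \<mu>) ?\<sigma> = m"
        using \<tau> by (simp add: S_def cong: content_cong)
      ultimately show "?\<sigma> \<in> fillings ls \<and> content (dg \<mu>) ?\<sigma> = m"
        by (simp add: fillings_def \<mu>_def)
    qed
    have F: "\<sigma> u \<in> Poly_Mapping.keys m \<and> \<sigma> u \<in> set xs"
      if "\<sigma> \<in> fillings ls" "content (dg \<mu>) \<sigma> = m" "u \<in> dg \<mu>" for \<sigma> u
    proof -
      have "\<sigma> u \<in> Poly_Mapping.keys m"
        using in_keys_content[OF finite_dg that(3), of \<sigma>] that(2) by simp
      moreover obtain j i where "\<sigma> u = (j, i)"
        by (cases "\<sigma> u")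
      moreover have "\<sigma> \<in> dg \<mu> \<rightarrow>\<^sub>E {(j, i). j < length ls}"
        using that(1) by (simp add: fillings_def \<mu>_def)
      then have "\<sigma> u \<in> {(j, i). j < length ls}"
        using that(3) by (rule PiE_mem)
      ultimately show ?thesis
        using large[of j i] by (simp add: xs_def in_block_vars)
    qed
    show "\<forall>\<sigma>\<in>{\<sigma> \<in> fillings ls. content (dg \<mu>) \<sigma> = m}.
        restrict (\<lambda>u. xs ! (if u \<in> dg \<mu> then pos (\<sigma> u) else \<tau>0 u)) (dg \<mu>) = \<sigma>"
    proof
      fix \<sigma> assume \<sigma>: "\<sigma> \<in> {\<sigma> \<in> fillings ls. content (dg \<mu>) \<sigma> = m}"
      then have "\<sigma> \<in> extensional (dg \<mu>)"
        by (auto simp: fillings_def \<mu>_def PiE_def)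
      then show "restrict (\<lambda>u. xs ! (if u \<in> dg \<mu> then pos (\<sigma> u) else \<tau>0 u)) (dg \<mu>) = \<sigma>"
        using \<sigma> F pos' by (auto simp: fun_eq_iff restrict_def extensional_def)
    qed
    show "(\<lambda>\<sigma> u. if u \<in> dg \<mu> then pos (\<sigma> u) else \<tau>0 u) ` {\<sigma> \<in> fillings ls. content (dg \<mu>) \<sigma> = m} \<subseteq> S"
    proof clarify
      fix \<sigma> assume \<sigma>: "\<sigma> \<in> fillings ls" "m = content (dg \<mu>) \<sigma>"
      let ?\<tau> = "\<lambda>u. if u \<in> dg \<mu> then pos (\<sigma> u) else \<tau>0 u"
      have F': "\<sigma> u \<in> Poly_Mapping.keys m" "xs ! pos (\<sigma> u) = \<sigma> u" "pos (\<sigma> u) < N" if "u \<in> dg \<mu>" for u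
        using F[OF \<sigma>(1) \<sigma>(2)[symmetric] that] pos'[of "\<sigma> u"] by auto
      have "non_attacking \<mu> (augment ls \<sigma>) \<and> decreasing_upwards \<mu> (augment ls \<sigma>) \<and>
          (\<nexists>u v w. coinversion_triple \<mu> (augment ls \<sigma>) u v w)"
        using \<sigma>(1) by (simp add: fillings_def \<mu>_def)
      then have "runs \<mu> ?\<tau> Q"
        using F' by (subst runs_iff[of ?\<tau> \<sigma>]) auto
      moreover have "content (dg \<mu>) (\<lambda>u. xs ! ?\<tau> u) = content (dg \<mu>) \<sigma>"
        using F' by (intro content_cong) simp
      ultimately show "?\<tau> \<in> S"
        using \<sigma>(2) by (simp add: S_def completions_def boxes)
    qed
  qed
  show ?thesis
    using lookup bij_betw_same_card[OF bij] by (simp add: xs_def \<alpha>_def \<mu>_def)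
qed

section \<open>The limit over the numbers of variables\<close>

lemma all_at_top_neq_bot: "all_at_top r \<noteq> bot"
proof -
  \<comment> \<open>Along constant families all coordinates tend to infinity together; the filter is
    therefore proper and \<open>Lim\<close> is determined.\<close>
  have "filtermap (\<lambda>k _. k) at_top \<le> all_at_top r"
    unfolding all_at_top_def filterlim_def[symmetric]
    by (simp add: filterlim_INF filterlim_filtercomap_iff comp_def filterlim_ident)
  moreover have "filtermap (\<lambda>k _. k) (at_top :: nat filter) \<noteq> bot"
    by (simp add: filtermap_bot_iff)
  ultimately show ?thesis
    by (metis bot.extremum_uniqueI)
qed

lemma eventually_all_at_top: "\<forall>\<^sub>F n in all_at_top r. \<forall>j<r. K j \<le> n j"
proof -
  have "\<forall>\<^sub>F n in all_at_top r. K j \<le> n j" if "j \<in> {..<r}" for j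
  proof (rule filter_leD)
    show "all_at_top r \<le> filtercomap (\<lambda>n. n j) at_top"
      unfolding all_at_top_def using that by (rule INF_lower)
    show "\<forall>\<^sub>F n in filtercomap (\<lambda>n. n j) at_top. K j \<le> n j"
      unfolding eventually_filtercomap by (intro exI[of _ "\<lambda>k. K j \<le> k"]) (simp add: eventually_ge_at_top)
  qed
  then have "\<forall>\<^sub>F n in all_at_top r. \<forall>j\<in>{..<r}. K j \<le> n j"
    by (intro eventually_ball_finite) auto
  then show ?thesis
    by (simp only: Ball_def lessThan_iff)
qed

text \<open>All labels are among the finitely many variables of \<open>m\<close>.\<close>

lemma finite_fillings_content: "finite {\<sigma> \<in> fillings ls. content (dg (shape ls)) \<sigma> = m}"
proof (rule finite_subset)
  show "{\<sigma> \<in> fillings ls. content (dg (shape ls)) \<sigma> = m} \<subseteq> dg (shape ls) \<rightarrow>\<^sub>E Poly_Mapping.keys m"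
  proof clarify
    fix \<sigma> assume "\<sigma> \<in> fillings ls" "m = content (dg (shape ls)) \<sigma>"
    moreover from this have "\<sigma> \<in> extensional (dg (shape ls))"
      by (simp add: fillings_def PiE_def)
    ultimately show "\<sigma> \<in> dg (shape ls) \<rightarrow>\<^sub>E Poly_Mapping.keys (content (dg (shape ls)) \<sigma>)"
      using in_keys_content[OF finite_dg] by (intro PiE_I) (auto simp: extensional_def)
  qed
qed (simp add: finite_PiE finite_dg)

text \<open>Formal series are compared coefficient by coefficient; the set of fillings is infinite
  in general, but each coefficient receives finitely many nonzero terms.\<close>

theorem mainTheorem4:
  fixes ls :: "nat list list"
  assumes "\<forall>l \<in> set ls. is_partition l"
  shows "\<forall>m. ((\<lambda>\<sigma>. Poly_Mapping.lookup (filling_weight ls \<sigma>) m) has_sum multi_schur ls m) (fillings ls)"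
proof
  fix m :: "(nat \<times> nat) mono"
  let ?F = "{\<sigma> \<in> fillings ls. content (dg (shape ls)) \<sigma> = m}"
  let ?key = "\<lambda>n. Poly_Mapping.lookup (key_poly (block_vars ls n) (padded_comp ls n)) m"
  have lookup: "Poly_Mapping.lookup (filling_weight ls \<sigma>) m = (if content (dg (shape ls)) \<sigma> = m then 1 else 0)" for \<sigma>
    unfolding filling_weight_eq by (rule lookup_prod_var[OF finite_dg])
  \<comment> \<open>The sum bounds every index occurring in \<open>m\<close>; adding
    \<open>Suc\<close> and the length keeps these indices strictly before the basement
    positions.\<close>
  define K where "K j = length (ls ! j) + Suc (\<Sum>x\<in>Poly_Mapping.keys m. snd x)" for j
  have "\<forall>\<^sub>F n in all_at_top (length ls). ?key n = int (card ?F)"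
    using eventually_all_at_top[of "length ls" K]
  proof (rule eventually_mono)
    fix n assume n: "\<forall>j<length ls. K j \<le> n j"
    show "?key n = int (card ?F)"
    proof (rule lookup_key_poly_eq_card[OF assms])
      show "\<forall>j<length ls. length (ls ! j) \<le> n j"
        using n by (auto simp: K_def)
      show "i < n j - length (ls ! j)" if "j < length ls" "(j, i) \<in> Poly_Mapping.keys m" for j i
      proof -
        have "i \<le> (\<Sum>x\<in>Poly_Mapping.keys m. snd x)"
          using member_le_sum[OF that(2), of snd] by simp
        then show ?thesis
          using n that(1) by (auto simp: K_def)
      qed
    qed
  qed
  then have "multi_schur ls m = int (card ?F)"
    unfolding multi_schur_def by (intro tendsto_Lim all_at_top_neq_bot tendsto_eventually)
  then show "((\<lambda>\<sigma>. Poly_Mapping.lookup (filling_weight ls \<sigma>) m) has_sum multi_schur ls m) (fillings ls)"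
    using finite_fillings_content[of ls m] by (intro has_sum_finite_neutralI[of ?F]) (auto simp: lookup)
qed

end
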